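(* Assume that $\inf_{x\in D}R(x)>0$, that the sequence of positive functions $\beta_n\in\mathcal{B}(D)$, $n\ge 0$, is uniformly bounded (i.e. $\sup_n\sup_{x\in D}\beta_n(x)<\infty$) and converges uniformly on $D$, as $n\to\infty$, to a function $\beta\in\mathcal{B}(D)$ such that $\inf_{x\in D}\beta(x)>0$. Then the law of large numbers holds for the random measures $\mu_m$: for any function $f\in\mathcal{B}(D)$, $$\frac{1}{m}\int_D f(x)\,d\mu_m(x)=\frac1m\sum_{i=1}^m f(X_i)\;\longrightarrow\; J(f)=\frac{1}{\alpha}\int_D f(x)\beta(x)\,dx$$ in probability as $m\to\infty$, where $\alpha=\int_D\beta(x)\,dx$.
   Context: Let $D\subset\mathbf{R}^d$ be a compact set of positive Lebesgue measure and let $\mathcal{B}(D)$ be the set of real-valued measurable bounded functions on $D$. Let $R:D\to\mathbf{R}_+$ be a measurable function (interaction radius). For $x\in D$ and a finite non-empty set $\mathbf{y}=\{y_1,\dots,y_n\}$ of points of $D$, $n(x,\mathbf{y})$ denotes the number of points $y_i\in\mathbf{y}$ whose distance to $x$ is not greater than $R(x)$; by definition $n(x,\emptyset)=0$. Let $\{\beta_n(x),\,n\ge 0\}$ be a sequence of measurable positive bounded functions on $D$. The random points $X_1,X_2,\dots$ in $D$ are defined sequentially on a probability space with measure $\mathsf{P}$: writing $X(k)=(X_1,\dots,X_k)$ for $k\ge1$ and $X(0)=\emptyset$, the conditional distribution of $X_{k+1}$ given $X(k)$ ($k\ge 0$) has probability density $$\psi_{k+1}(x)=\frac{\beta_{n(x,X(k))}(x)}{\alpha(X(k))},\quad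 x\in D,\qquad \alpha(X(k))=\int_D\beta_{n(u,X(k))}(u)\,du .$$ The random point measures are $\mu_m=\sum_{i=1}^m\delta_{X_i}$. *)

theory Defs
  imports "HOL-Probability.Probability"
begin

text \<open>Functions on \<open>D\<close> are represented by functions on the whole space of which only the restriction
  to \<open>D\<close> matters; measurability on \<open>D\<close> is Borel measurability.\<close>

definition bounded_measurable_on :: "'a::euclidean_space set \<Rightarrow> ('a \<Rightarrow> real) set" where
  "bounded_measurable_on D = {f \<in> borel_measurable (restrict_space borel D). bounded (f ` D)}"

definition num_neighbours :: "('a::euclidean_space \<Rightarrow> real) \<Rightarrow> 'a \<Rightarrow> 'a set \<Rightarrow> nat" where
  "num_neighbours R x Y = card {y \<in> Y. dist x y \<le> R x}"

definition weight :: "('a::euclidean_space \<Rightarrow> real) \<Rightarrow> (nat \<Rightarrow> 'a \<Rightarrow> real) \<Rightarrow> 'a set \<Rightarrow> 'a \<Rightarrow> real" where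
  "weight R \<beta> Y x = \<beta> (num_neighbours R x Y) x"

definition seq_density ::
    "'a::euclidean_space set \<Rightarrow> ('a \<Rightarrow> real) \<Rightarrow> (nat \<Rightarrow> 'a \<Rightarrow> real) \<Rightarrow> 'a set \<Rightarrow> 'a \<Rightarrow> real" where
  "seq_density D R \<beta> Y x = weight R \<beta> Y x / (LBINT u:D. weight R \<beta> Y u)"

text \<open>The sigma-algebra generated by \<open>X\<^sub>1, \<dots>, X\<^sub>k\<close>, as a measurable space on \<open>space M\<close>; for
  \<open>k = 0\<close> it is the trivial one.\<close>

definition history ::
    "'w measure \<Rightarrow> 'a::euclidean_space set \<Rightarrow> (nat \<Rightarrow> 'w \<Rightarrow> 'a) \<Rightarrow> nat \<Rightarrow> 'w measure" where
  "history M D X k =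
     vimage_algebra (space M) (\<lambda>w. \<lambda>i\<in>{1..k}. X i w) (\<Pi>\<^sub>M i\<in>{1..k}. restrict_space borel D)"

text \<open>The conditional distribution of the \<open>D\<close>-valued random variable \<open>Y\<close> given the sub-sigma-algebra
  \<open>F\<close> has, with respect to Lebesgue measure, the (random) density \<open>g w\<close> on \<open>D\<close>.\<close>

definition has_cond_density ::
    "'w measure \<Rightarrow> 'w measure \<Rightarrow> 'a::euclidean_space set \<Rightarrow> ('w \<Rightarrow> 'a) \<Rightarrow> ('w \<Rightarrow> 'a \<Rightarrow> real) \<Rightarrow> bool" where
  "has_cond_density M F D Y g \<longleftrightarrow>
     (\<forall>A \<in> sets (restrict_space borel D).
        AE w in M. real_cond_exp M F (indicator (Y -` A \<inter> space M)) w = (LBINT x:A. g w x))"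

text \<open>The indices of the points start at \<open>1\<close>; \<open>X 0\<close> is unused. The set \<open>{X\<^sub>1, \<dots>, X\<^sub>k}\<close> of the points
  chosen so far is empty for \<open>k = 0\<close>.\<close>

definition sequential_points ::
    "'w measure \<Rightarrow> 'a::euclidean_space set \<Rightarrow> ('a \<Rightarrow> real) \<Rightarrow> (nat \<Rightarrow> 'a \<Rightarrow> real) \<Rightarrow> (nat \<Rightarrow> 'w \<Rightarrow> 'a) \<Rightarrow> bool"
  where
  "sequential_points M D R \<beta> X \<longleftrightarrow>
     (\<forall>i\<ge>1. X i \<in> M \<rightarrow>\<^sub>M restrict_space borel D) \<and>
     (\<forall>k. has_cond_density M (history M D X k) D (X (Suc k))
            (\<lambda>w. seq_density D R \<beta> ((\<lambda>i. X i w) ` {1..k})))"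

definition point_measure_seq ::
    "'a::euclidean_space set \<Rightarrow> (nat \<Rightarrow> 'w \<Rightarrow> 'a) \<Rightarrow> nat \<Rightarrow> 'w \<Rightarrow> 'a measure" where
  "point_measure_seq D X m w =
     measure_of D (sets (restrict_space borel D))
       (\<lambda>A. \<Sum>i=1..m. emeasure (return (restrict_space borel D) (X i w)) A)"

definition converges_in_probability ::
    "'w measure \<Rightarrow> (nat \<Rightarrow> 'w \<Rightarrow> real) \<Rightarrow> ('w \<Rightarrow> real) \<Rightarrow> bool" where
  "converges_in_probability M Z L \<longleftrightarrow>
     (\<forall>m. Z m \<in> borel_measurable M) \<and> L \<in> borel_measurable M \<and>
     (\<forall>\<epsilon>>0. (\<lambda>m. measure M {w \<in> space M. \<bar>Z m w - L w\<bar> > \<epsilon>}) \<longlonglongrightarrow> 0)"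

end

theory Submission
  imports Defs
begin

text \<open>The densities \<open>\<beta> n\<close> converge to a limit bounded away from zero, so \<open>INF n. \<beta> n x\<close> is positive at
  every point, and a set of positive measure is hit by the next point with conditional probability
  at least some \<open>\<delta> > 0\<close>, whatever the past. Hence the probability that the set is missed \<open>k\<close> times
  decays geometrically. Cover \<open>D\<close> by finitely many balls of radius \<open>r/2\<close>, where \<open>r\<close> is a lower bound
  of \<open>R\<close>, and cut each into \<open>L\<close> disjoint sets of positive measure: once all of them are hit, almost
  every \<open>x\<close> has at least \<open>L\<close> neighbours and the conditional density is uniformly close to
  \<open>\<beta>lim / \<alpha>\<close>. Therefore the conditional probabilities of \<open>X (Suc k) \<in> A\<close> converge in mean to their
  limit \<open>J A\<close>, and a second moment computation gives the law of large numbers for indicators.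
  Uniform approximation by simple functions extends it to bounded functions.\<close>

section \<open>Disjoint pieces of positive measure and forced neighbours\<close>

text \<open>A ball of small enough radius has less volume than \<open>A\<close>, so it cannot
  exhaust \<open>A\<close>. Finitely many such balls cover \<open>A\<close>, and not all of them can
  meet \<open>A\<close> in a null set; one with an intersection of positive measure provides
  \<open>B\<close>.\<close>

lemma lborel_pos_split:
  fixes A :: "'a::euclidean_space set"
  assumes A: "A \<in> sets borel" "bounded A" "emeasure lborel A > 0"
  obtains B where "B \<in> sets borel" "B \<subseteq> A" "emeasure lborel B > 0" "emeasure lborel (A - B) > 0"
proof -
  define v where "v = measure lborel (ball (0::'a) 1)"
  have v: "v > 0" unfolding v_def by (rule content_ball_pos) simp
  have fin: "emeasure lborel A < \<infinity>" using A(2) by (rule emeasure_bounded_finite)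
  define a where "a = measure lborel A"
  have a: "emeasure lborel A = ennreal a"
    unfolding a_def using fin by (intro emeasure_eq_ennreal_measure) auto
  with A(3) have "a > 0" by simp
  note a = a this
  \<comment> \<open>The cap 1 gives \<open>r ^ DIM('a) \<le> r\<close>, so a ball of radius
    \<open>r\<close> has volume at most \<open>r * v\<close>. The other bound makes this at most
    \<open>a / 2\<close>.\<close>
  define r where "r = min 1 (a / (2 * v))"
  have r: "0 < r" "r \<le> 1" "r \<le> a / (2 * v)" using a v by (auto simp: r_def)
  have small: "emeasure lborel (ball c r) < emeasure lborel A" for c :: 'a
  proof -
    have "r ^ DIM('a) \<le> r ^ 1" using r by (intro power_decreasing) (auto simp: Suc_leI)
    then have "measure lborel (ball c r) \<le> r * v"
      using content_ball_conv_unit_ball[of r c] r v by (auto simp: v_def)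
    also have "\<dots> \<le> a / (2 * v) * v" using r v by (intro mult_right_mono) auto
    also have "\<dots> < a" using v a by simp
    finally have "measure lborel (ball c r) < a" .
    moreover have "emeasure lborel (ball c r) = ennreal (measure lborel (ball c r))"
      using emeasure_lborel_ball_finite[of c r] by (subst emeasure_eq_ennreal_measure) auto
    ultimately show ?thesis using a by (simp add: ennreal_less_iff)
  qed
  obtain K where K: "finite K" "closure A \<subseteq> (\<Union>c\<in>K. ball c r)"
    using A(2) r(1) compact_closure[of A] unfolding compact_eq_totally_bounded by blast
  have "\<exists>c\<in>K. emeasure lborel (A \<inter> ball c r) \<noteq> 0"
  proof (rule ccontr)
    assume "\<not> ?thesis"
    then have "(\<Union>c\<in>K. A \<inter> ball c r) \<in> null_sets lborel"
      using K(1) A(1) by (intro null_sets_UN' countable_finite) (auto simp: null_sets_def)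
    moreover have "(\<Union>c\<in>K. A \<inter> ball c r) = A" using K(2) closure_subset[of A] by blast
    ultimately show False using A(3) by (simp add: null_sets_def)
  qed
  then obtain c where c: "emeasure lborel (A \<inter> ball c r) \<noteq> 0" by blast
  have "emeasure lborel (A - A \<inter> ball c r) \<noteq> 0"
  proof
    assume 0: "emeasure lborel (A - A \<inter> ball c r) = 0"
    have "emeasure lborel A \<le> emeasure lborel ((A - A \<inter> ball c r) \<union> ball c r)"
      using A(1) by (intro emeasure_mono) auto
    also have "\<dots> \<le> emeasure lborel (A - A \<inter> ball c r) + emeasure lborel (ball c r)"
      using A(1) by (intro emeasure_subadditive) auto
    finally show False using 0 small[of c] by simp
  qed
  then show thesis using that[of "A \<inter> ball c r"] A(1) c by (auto simp: zero_less_iff_neq_zero)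
qed

text \<open>Since \<open>num_neighbours\<close> counts distinct points, hitting one set often is not enough; hitting
  many disjoint sets once forces many distinct points without showing that the \<open>X i\<close> are almost
  surely distinct.\<close>

lemma lborel_pos_disjoint_pieces:
  fixes A :: "'a::euclidean_space set"
  assumes "A \<in> sets borel" "bounded A" "emeasure lborel A > 0"
  shows "\<exists>\<P>. finite \<P> \<and> card \<P> = n \<and> disjoint \<P> \<and>
           (\<forall>P\<in>\<P>. P \<in> sets borel \<and> P \<subseteq> A \<and> emeasure lborel P > 0)"
  using assms
proof (induction n arbitrary: A)
  case 0
  then show ?case by (intro exI[of _ "{}"]) auto
next
  case (Suc n)
  obtain B where B: "B \<in> sets borel" "B \<subseteq> A" "emeasure lborel B > 0" "emeasure lborel (A - B) > 0"
    using lborel_pos_split[OF Suc.prems] by blast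
  have "A - B \<in> sets borel" "bounded (A - B)"
    using Suc.prems B(1) by (auto intro: bounded_subset)
  then obtain \<P> where \<P>: "finite \<P>" "card \<P> = n" "disjoint \<P>"
    "\<forall>P\<in>\<P>. P \<in> sets borel \<and> P \<subseteq> A - B \<and> emeasure lborel P > 0"
    using Suc.IH[of "A - B"] B(4) by blast
  \<comment> \<open>If \<open>B\<close> were a member of \<open>\<P>\<close>, it would lie in
    \<open>A - B\<close> and be empty. Hence inserting it really raises the cardinality.\<close>
  have "B \<noteq> {}" using B(3) by auto
  then have "B \<notin> \<P>" using \<P>(4) by auto
  moreover have "disjoint (insert B \<P>)"
    using \<P>(3,4) by (auto simp: pairwise_insert disjnt_def)
  ultimately show ?case using \<P> B by (intro exI[of _ "insert B \<P>"]) auto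
qed

text \<open>Choosing a point of \<open>Y\<close> in each member of the family is injective, because
  disjoint members cannot share the chosen point.\<close>

lemma card_ge_if_meets_disjoint:
  assumes "finite \<P>" "disjoint \<P>" "finite Y" "\<And>P. P \<in> \<P> \<Longrightarrow> Y \<inter> P \<noteq> {}" "\<Union>\<P> \<subseteq> A"
  shows "card \<P> \<le> card (Y \<inter> A)"
proof -
  obtain h where h: "\<And>P. P \<in> \<P> \<Longrightarrow> h P \<in> Y \<inter> P" using assms(4) by (meson all_not_in_conv)
  have "inj_on h \<P>"
  proof (rule inj_onI)
    fix P Q assume "P \<in> \<P>" "Q \<in> \<P>" "h P = h Q"
    then show "P = Q" using h[of P] h[of Q] disjointD[OF assms(2), of P Q] by auto
  qed
  then show ?thesis using h assms by (intro card_inj_on_le[of h]) auto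
qed

text \<open>Two points in one ball of radius \<open>r/2\<close> are at distance at most
  \<open>r\<close>. Each cell \<open>E c\<close> of positive measure is cut into \<open>L\<close>
  disjoint pieces, so a set \<open>Y\<close> that meets all pieces has \<open>L\<close> distinct
  points close to every \<open>x\<close> of that cell. The exceptional null set consists of the
  discarded cells and is the same for all \<open>Y\<close>.\<close>

lemma neighbour_forcing_family:
  fixes D :: "'a::euclidean_space set"
  assumes D: "compact D" and r: "r > 0"
  shows "\<exists>\<A>. finite \<A> \<and> (\<forall>A\<in>\<A>. A \<in> sets borel \<and> A \<subseteq> D \<and> emeasure lborel A > 0) \<and>
           (AE x in lborel. x \<in> D \<longrightarrow> (\<forall>Y. finite Y \<longrightarrow> (\<forall>A\<in>\<A>. Y \<inter> A \<noteq> {}) \<longrightarrow>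
              L \<le> card {y \<in> Y. dist x y \<le> r}))"
proof -
  obtain K where K: "finite K" "D \<subseteq> (\<Union>c\<in>K. ball c (r/2))"
    using D r unfolding compact_eq_totally_bounded by (meson half_gt_zero)
  have Db: "D \<in> sets borel" using D by (simp add: borel_closed compact_imp_closed)
  define E where "E c = D \<inter> ball c (r/2)" for c
  have E: "E c \<in> sets borel" "bounded (E c)" "E c \<subseteq> D" for c
    using Db D by (auto simp: E_def intro: bounded_subset compact_imp_bounded)
  define K' where "K' = {c \<in> K. emeasure lborel (E c) > 0}"
  have "\<forall>c\<in>K'. \<exists>\<P>. finite \<P> \<and> card \<P> = L \<and> disjoint \<P> \<and>
           (\<forall>P\<in>\<P>. P \<in> sets borel \<and> P \<subseteq> E c \<and> emeasure lborel P > 0)"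
    using lborel_pos_disjoint_pieces[OF E(1,2)] by (auto simp: K'_def)
  then obtain \<P> where \<P>: "\<And>c. c \<in> K' \<Longrightarrow> finite (\<P> c) \<and> card (\<P> c) = L \<and> disjoint (\<P> c) \<and>
           (\<forall>P\<in>\<P> c. P \<in> sets borel \<and> P \<subseteq> E c \<and> emeasure lborel P > 0)"
    by metis
  \<comment> \<open>Cells of measure zero cannot be cut into pieces of positive measure; together
    they form the null set that the almost-everywhere claim leaves out.\<close>
  have "(\<Union>c\<in>K-K'. E c) \<in> null_sets lborel"
    using K(1) E(1) by (intro null_sets_UN' countable_finite)
      (auto simp: null_sets_def K'_def zero_less_iff_neq_zero)
  then have "AE x in lborel. x \<notin> (\<Union>c\<in>K-K'. E c)" by (rule AE_not_in)
  then have "AE x in lborel. x \<in> D \<longrightarrow> (\<forall>Y. finite Y \<longrightarrow> (\<forall>A\<in>\<Union>(\<P> ` K'). Y \<inter> A \<noteq> {}) \<longrightarrow>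
              L \<le> card {y \<in> Y. dist x y \<le> r})"
  proof (eventually_elim, intro impI allI)
    fix x and Y :: "'a set"
    assume x: "x \<notin> (\<Union>c\<in>K-K'. E c)" "x \<in> D" and Y: "finite Y" "\<forall>A\<in>\<Union>(\<P> ` K'). Y \<inter> A \<noteq> {}"
    then obtain c where c: "c \<in> K'" "x \<in> ball c (r/2)" using K(2) unfolding E_def by blast
    have "L = card (\<P> c)" using \<P>[OF c(1)] by auto
    also have "\<dots> \<le> card (Y \<inter> E c)"
      using \<P>[OF c(1)] Y c(1) by (intro card_ge_if_meets_disjoint) auto
    also have "\<dots> \<le> card {y \<in> Y. dist x y \<le> r}"
    proof (intro card_mono subsetI)
      fix y assume y: "y \<in> Y \<inter> E c"
      have "dist x y \<le> dist c x + dist c y" by (metis dist_commute dist_triangle)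
      then show "y \<in> {y \<in> Y. dist x y \<le> r}" using y c(2) by (auto simp: E_def)
    qed (use Y in auto)
    finally show "L \<le> card {y \<in> Y. dist x y \<le> r}" .
  qed
  moreover have "finite (\<Union>(\<P> ` K'))" using \<P> K(1) by (auto simp: K'_def)
  moreover have "\<forall>A\<in>\<Union>(\<P> ` K'). A \<in> sets borel \<and> A \<subseteq> D \<and> emeasure lborel A > 0"
    using \<P> E(3) by fast
  ultimately show ?thesis by blast
qed

section \<open>Measurability, integrability and the point measure\<close>

text \<open>Extension by zero outside \<open>D\<close> turns measurability on the restricted space
  into Borel measurability, and a bounded function is integrable over a compact set because the
  latter has finite volume.\<close>

lemma bounded_measurable_on_set_integrable:
  fixes D :: "'a::euclidean_space set"
  assumes D: "compact D" and h: "h \<in> bounded_measurable_on D" and A: "A \<in> sets borel" "A \<subseteq> D"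
  shows "set_integrable lborel A h"
proof -
  have Db: "D \<in> sets borel" using D by (simp add: borel_closed compact_imp_closed)
  obtain C where C: "\<And>x. x \<in> D \<Longrightarrow> \<bar>h x\<bar> \<le> C"
    using h by (auto simp: bounded_measurable_on_def bounded_iff)
  have "(\<lambda>x. indicator D x *\<^sub>R h x) \<in> borel_measurable lborel"
    using h Db by (subst (asm) bounded_measurable_on_def)
      (simp add: borel_measurable_restrict_space_iff)
  moreover have "emeasure lborel D < \<infinity>"
    using D by (intro emeasure_bounded_finite compact_imp_bounded)
  ultimately have "set_integrable lborel D h"
    unfolding set_integrable_def using Db C
    by (intro integrableI_bounded_set[where A = D and B = C]) (auto simp: indicator_def)
  then show ?thesis using A by (auto intro: set_integrable_subset)
qed

lemma measurable_num_neighbours: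
  fixes D :: "'a::euclidean_space set"
  assumes R[measurable]: "R \<in> borel_measurable (restrict_space borel D)" and Y: "finite Y"
  shows "(\<lambda>x. num_neighbours R x Y) \<in> restrict_space borel D \<rightarrow>\<^sub>M count_space UNIV"
proof -
  have [measurable]: "(\<lambda>x. x) \<in> borel_measurable (restrict_space borel D)"
    by (rule measurable_restrict_space1) simp
  have "num_neighbours R x Y = (\<Sum>y\<in>Y. if dist x y \<le> R x then 1 else 0)" for x
    using Y by (simp add: num_neighbours_def sum.If_cases Int_def)
  then show ?thesis by simp
qed

text \<open>The neighbour count takes countably many values, so the weight is a countable patchwork
  of the measurable functions \<open>\<beta> n\<close> over measurable pieces of
  \<open>D\<close>.\<close>

lemma weight_bounded_measurable_on:
  fixes D :: "'a::euclidean_space set"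
  assumes R: "R \<in> borel_measurable (restrict_space borel D)" and Y: "finite Y"
    and \<beta>: "\<And>n. \<beta> n \<in> borel_measurable (restrict_space borel D)"
    and pos: "\<And>n x. x \<in> D \<Longrightarrow> 0 < \<beta> n x" and C: "\<And>n x. x \<in> D \<Longrightarrow> \<beta> n x \<le> C"
  shows "weight R \<beta> Y \<in> bounded_measurable_on D"
proof -
  have "(\<lambda>x. \<beta> (num_neighbours R x Y) x) \<in> borel_measurable (restrict_space borel D)"
    by (rule measurable_compose_countable[OF \<beta> measurable_num_neighbours[OF R Y]])
  moreover have "bounded (weight R \<beta> Y ` D)"
    using pos C by (intro boundedI[of _ C]) (auto simp: weight_def abs_of_pos)
  ultimately show ?thesis by (simp add: bounded_measurable_on_def weight_def[abs_def])
qed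

text \<open>The point measure is the image of the counting measure on the indices
  \<open>{1..m}\<close> under \<open>\<lambda>i. X i w\<close>; repeated points thus keep their
  multiplicity, and the change of variables formula gives a finite sum.\<close>

lemma integral_point_measure_seq:
  fixes D :: "'a::euclidean_space set"
  assumes X: "\<And>i. i \<in> {1..m} \<Longrightarrow> X i w \<in> D" and f: "f \<in> borel_measurable (restrict_space borel D)"
  shows "(\<integral>x. f x \<partial>point_measure_seq D X m w) = (\<Sum>i=1..m. f (X i w) :: real)"
proof -
  let ?N = "restrict_space borel D"
  let ?P = "distr (count_space {1..m}) ?N (\<lambda>i. X i w)"
  have meas: "(\<lambda>i. X i w) \<in> count_space {1..m} \<rightarrow>\<^sub>M ?N" using X by (auto simp: space_restrict_space)
  have "point_measure_seq D X m w = measure_of D (sets ?N) (emeasure ?P)"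
    unfolding point_measure_seq_def
  proof (rule measure_of_eq)
    show "sets ?N \<subseteq> Pow D" by (auto simp: sets_restrict_space)
    fix a assume "a \<in> sigma_sets D (sets ?N)"
    then have a: "a \<in> sets ?N"
      using sets.sigma_sets_eq[of ?N] by (simp add: space_restrict_space)
    have "emeasure ?P a = of_nat (card {i \<in> {1..m}. X i w \<in> a})"
      using a meas by (subst emeasure_distr)
        (auto simp: emeasure_count_space subset_eq intro!: arg_cong[where f = card])
    also have "\<dots> = (\<Sum>i=1..m. if X i w \<in> a then 1 else 0)"
      by (simp add: sum.If_cases Int_def)
    finally show "(\<Sum>i=1..m. emeasure (return ?N (X i w)) a) = emeasure ?P a"
      using a by (simp add: indicator_def of_bool_def)
  qed
  also have "\<dots> = ?P" using measure_of_of_measure[of ?P] by (simp add: space_restrict_space)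
  finally have "point_measure_seq D X m w = ?P" .
  then show ?thesis using meas f
    by (simp add: integral_distr lebesgue_integral_count_space_finite)
qed

lemma cesaro_tendsto_zero:
  fixes \<eta> :: "nat \<Rightarrow> real"
  assumes "\<eta> \<longlonglongrightarrow> 0"
  shows "(\<lambda>m. (\<Sum>k<m. \<eta> k) / real m) \<longlonglongrightarrow> 0"
proof (rule LIMSEQ_I)
  fix e :: real assume e: "e > 0"
  obtain N where N: "\<And>k. k \<ge> N \<Longrightarrow> \<bar>\<eta> k\<bar> < e / 2"
    using LIMSEQ_D[OF assms, of "e / 2"] e by auto
  define K where "K = (\<Sum>k<N. \<bar>\<eta> k\<bar>)"
  obtain N' where N': "real N' > 2 * K / e" using reals_Archimedean2 by blast
  show "\<exists>n0. \<forall>m\<ge>n0. norm ((\<Sum>k<m. \<eta> k) / real m - 0) < e"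
  proof (intro exI allI impI)
    \<comment> \<open>\<open>Suc N\<close> keeps \<open>m\<close> positive for the division, and
      \<open>N'\<close> makes the head \<open>K\<close> smaller than
      \<open>m * e / 2\<close>.\<close>
    fix m assume m: "m \<ge> max (Suc N) N'"
    have "\<bar>\<Sum>k<m. \<eta> k\<bar> \<le> (\<Sum>k<m. \<bar>\<eta> k\<bar>)" by (rule sum_abs)
    also have "\<dots> = K + (\<Sum>k=N..<m. \<bar>\<eta> k\<bar>)"
      using m sum.atLeastLessThan_concat[of 0 N m "\<lambda>k. \<bar>\<eta> k\<bar>"] by (simp add: K_def lessThan_atLeast0)
    also have "(\<Sum>k=N..<m. \<bar>\<eta> k\<bar>) \<le> (\<Sum>k=N..<m. e / 2)"
      using N by (intro sum_mono) (auto simp: less_imp_le)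
    also have "\<dots> \<le> real m * (e / 2)" using e by (simp add: mult_right_mono)
    finally have 1: "\<bar>\<Sum>k<m. \<eta> k\<bar> \<le> K + real m * (e / 2)" by simp
    have "2 * K / e < real m" using N' m by linarith
    then have "2 * K < real m * e" using e by (simp add: divide_less_eq)
    then have "\<bar>\<Sum>k<m. \<eta> k\<bar> < real m * e" using 1 by simp
    moreover have "real m > 0" using m by simp
    ultimately show "norm ((\<Sum>k<m. \<eta> k) / real m - 0) < e"
      by (simp add: divide_less_eq mult.commute)
  qed
qed

section \<open>Deterministic estimates for the conditional density\<close>

text \<open>Explicit constants stand for the bounds of the theorem: \<open>r\<close> and
  \<open>b\<close> lie below \<open>R\<close> and \<open>\<beta>lim\<close>, and \<open>C\<close>
  lies above all \<open>\<beta> n\<close>. The estimates only ever use these pointwise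
  inequalities.\<close>

locale interaction =
  fixes D :: "'a::euclidean_space set"
    and R :: "'a \<Rightarrow> real"
    and \<beta> :: "nat \<Rightarrow> 'a \<Rightarrow> real"
    and \<beta>lim :: "'a \<Rightarrow> real"
    and r b C :: real
  assumes compact_D: "compact D" and pos_D: "emeasure lborel D > 0"
    and R_meas: "R \<in> borel_measurable (restrict_space borel D)"
    and r_pos: "r > 0" and R_ge: "\<And>x. x \<in> D \<Longrightarrow> r \<le> R x"
    and \<beta>_meas: "\<And>n. \<beta> n \<in> bounded_measurable_on D"
    and \<beta>_pos: "\<And>n x. x \<in> D \<Longrightarrow> 0 < \<beta> n x"
    and \<beta>_le: "\<And>n x. x \<in> D \<Longrightarrow> \<beta> n x \<le> C"
    and \<beta>lim_meas: "\<beta>lim \<in> bounded_measurable_on D"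
    and \<beta>_lim: "uniform_limit D \<beta> \<beta>lim sequentially"
    and b_pos: "b > 0" and \<beta>lim_ge: "\<And>x. x \<in> D \<Longrightarrow> b \<le> \<beta>lim x"
begin

definition J :: "'a set \<Rightarrow> real" where
  "J A = (LBINT x:A. \<beta>lim x) / (LBINT x:D. \<beta>lim x)"

lemma D_borel[measurable, simp]: "D \<in> sets borel"
  using compact_D by (simp add: borel_closed compact_imp_closed)

lemma sets_D: "A \<in> sets (restrict_space borel D) \<longleftrightarrow> A \<in> sets borel \<and> A \<subseteq> D"
  by (subst sets_restrict_space_iff) auto

lemma finite_D: "A \<subseteq> D \<Longrightarrow> emeasure lborel A < \<infinity>"
  using compact_D by (intro emeasure_bounded_finite bounded_subset[OF compact_imp_bounded])

lemma volume_D_pos: "measure lborel D > 0"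
proof -
  have "emeasure lborel D = ennreal (measure lborel D)"
    using finite_D[of D] by (intro emeasure_eq_ennreal_measure) auto
  with pos_D show ?thesis by simp
qed

lemma integrable_bounded_measurable:
  "h \<in> bounded_measurable_on D \<Longrightarrow> A \<in> sets borel \<Longrightarrow> A \<subseteq> D \<Longrightarrow> set_integrable lborel A h"
  by (rule bounded_measurable_on_set_integrable[OF compact_D])

lemma weight_meas: "finite Y \<Longrightarrow> weight R \<beta> Y \<in> bounded_measurable_on D"
  using \<beta>_meas by (intro weight_bounded_measurable_on[where C = C] R_meas \<beta>_pos \<beta>_le)
    (auto simp: bounded_measurable_on_def)

lemma const_meas: "(\<lambda>_. c) \<in> bounded_measurable_on D"
  by (auto simp: bounded_measurable_on_def intro!: boundedI[of _ "\<bar>c\<bar>"])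

lemma integral_const: "A \<in> sets borel \<Longrightarrow> A \<subseteq> D \<Longrightarrow> (LBINT x:A. c) = measure lborel A * (c::real)"
  using finite_D[of A] by (subst set_integral_const) auto

lemma integral_nonneg_mono_set:
  assumes h: "h \<in> bounded_measurable_on D" and A: "A \<in> sets borel" "B \<in> sets borel" "A \<subseteq> B" "B \<subseteq> D"
    and nn: "\<And>x. x \<in> D \<Longrightarrow> 0 \<le> h x"
  shows "0 \<le> (LBINT x:A. h x)" "(LBINT x:A. h x) \<le> (LBINT x:B. h x)"
proof -
  have i: "set_integrable lborel A h" "set_integrable lborel B h"
    using h A by (auto intro: integrable_bounded_measurable)
  show "0 \<le> (LBINT x:A. h x)"
    unfolding set_lebesgue_integral_def using A nn
    by (intro integral_nonneg_AE AE_I2) (auto simp: indicator_def)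
  show "(LBINT x:A. h x) \<le> (LBINT x:B. h x)"
    using i A nn unfolding set_lebesgue_integral_def set_integrable_def
    by (intro integral_mono) (auto simp: indicator_def)
qed

lemma total_ge: "b * measure lborel D \<le> (LBINT x:D. \<beta>lim x)"
proof -
  have "(LBINT x:D. b) \<le> (LBINT x:D. \<beta>lim x)"
    using \<beta>lim_ge by (intro set_integral_mono integrable_bounded_measurable const_meas \<beta>lim_meas) auto
  then show ?thesis by (simp add: integral_const mult.commute)
qed

lemma total_pos: "0 < (LBINT x:D. \<beta>lim x)"
  using total_ge mult_pos_pos[OF b_pos volume_D_pos] by linarith

lemma \<beta>lim_nonneg: "x \<in> D \<Longrightarrow> 0 \<le> \<beta>lim x"
  using \<beta>lim_ge b_pos by fastforce

lemma J_bounds: assumes "A \<in> sets borel" "A \<subseteq> D" shows "0 \<le> J A" "J A \<le> 1"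
  using integral_nonneg_mono_set[OF \<beta>lim_meas assms(1) _ assms(2), simplified, OF \<beta>lim_nonneg] total_pos
  by (auto simp: J_def)

text \<open>Positivity of each \<open>\<beta> n\<close> gives no common lower bound on all of
  \<open>A\<close>. But the sets \<open>B k\<close> where \<open>1 / Suc k\<close> is a bound for
  every \<open>n\<close> exhaust \<open>A\<close>, so by countable subadditivity one of them has
  positive measure.\<close>

lemma \<beta>_bounded_below:
  assumes A: "A \<in> sets borel" "A \<subseteq> D" "emeasure lborel A > 0"
  obtains A' q where "A' \<in> sets borel" "A' \<subseteq> A" "emeasure lborel A' > 0" "q > 0"
    "\<And>n x. x \<in> A' \<Longrightarrow> q \<le> \<beta> n x"
proof -
  define B where "B k = {x \<in> A. \<forall>n. 1 / Suc k \<le> \<beta> n x}" for k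
  have [measurable]: "\<beta> n \<in> borel_measurable (restrict_space borel D)" for n
    using \<beta>_meas by (simp add: bounded_measurable_on_def)
  have "{x \<in> space (restrict_space borel D). \<forall>n. 1 / Suc k \<le> \<beta> n x} \<in> sets (restrict_space borel D)" for k
    by measurable
  then have "{x \<in> D. \<forall>n. 1 / Suc k \<le> \<beta> n x} \<in> sets borel" for k
    by (simp add: sets_D space_restrict_space)
  moreover have "B k = A \<inter> {x \<in> D. \<forall>n. 1 / Suc k \<le> \<beta> n x}" for k
    using A by (auto simp: B_def)
  ultimately have B: "B k \<in> sets borel" for k using A by auto
  have "A \<subseteq> (\<Union>k. B k)"
  proof
    fix x assume x: "x \<in> A"
    then have xD: "x \<in> D" using A by auto
    obtain N where N: "\<And>n. n \<ge> N \<Longrightarrow> dist (\<beta> n x) (\<beta>lim x) < b / 2"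
      using uniform_limitD[OF \<beta>_lim, of "b/2"] b_pos xD by (auto simp: eventually_sequentially)
    \<comment> \<open>From index \<open>N\<close> on, \<open>\<beta> n x\<close> is within
      \<open>b / 2\<close> of a limit that is at least \<open>b\<close>; only finitely many earlier
      values, all positive, remain.\<close>
    define q where "q = Min (insert (b/2) ((\<lambda>n. \<beta> n x) ` {..<N}))"
    have q: "q > 0" using b_pos \<beta>_pos[OF xD] by (auto simp: q_def)
    have "q \<le> \<beta> n x" for n
    proof (cases "n < N")
      case True then show ?thesis by (auto simp: q_def)
    next
      case False
      then have "b / 2 \<le> \<beta> n x" using N[of n] \<beta>lim_ge[OF xD] unfolding dist_real_def by linarith
      moreover have "q \<le> b / 2" unfolding q_def by (rule Min_le) auto
      ultimately show ?thesis by linarith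
    qed
    moreover obtain k where "1 / Suc k < q" using q reals_Archimedean[of q] by (auto simp: inverse_eq_divide)
    ultimately have "1 / Suc k \<le> \<beta> n x" for n by (meson less_le_trans less_imp_le)
    then have "x \<in> B k" using x by (simp add: B_def)
    then show "x \<in> (\<Union>k. B k)" by auto
  qed
  have "\<exists>k. emeasure lborel (B k) \<noteq> 0"
  proof (rule ccontr)
    assume "\<not> ?thesis"
    then have "(\<Union>k. B k) \<in> null_sets lborel" using B by (intro null_sets_UN) (auto simp: null_sets_def)
    then have "A \<in> null_sets lborel"
      using \<open>A \<subseteq> (\<Union>k. B k)\<close> A(1) by (auto intro: null_sets_subset)
    then show False using A(3) by (simp add: null_sets_def)
  qed
  then obtain k where "emeasure lborel (B k) \<noteq> 0" by blast
  then show thesis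
    using B by (intro that[of "B k" "1 / Suc k"]) (auto simp: B_def zero_less_iff_neq_zero)
qed

text \<open>On the subset \<open>A'\<close> the bound \<open>q\<close> holds for every index of
  \<open>\<beta>\<close>, hence for whatever neighbour count \<open>Y\<close> produces. This makes
  \<open>\<kappa>\<close> independent of \<open>Y\<close>.\<close>

lemma integral_weight_ge:
  assumes A: "A \<in> sets borel" "A \<subseteq> D" "emeasure lborel A > 0"
  shows "\<exists>\<kappa>>0. \<forall>Y. finite Y \<longrightarrow> \<kappa> \<le> (LBINT x:A. weight R \<beta> Y x)"
proof -
  obtain A' q where A': "A' \<in> sets borel" "A' \<subseteq> A" "emeasure lborel A' > 0" "q > 0"
    "\<And>n x. x \<in> A' \<Longrightarrow> q \<le> \<beta> n x" using \<beta>_bounded_below[OF A] by blast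
  have "emeasure lborel A' = ennreal (measure lborel A')"
    using finite_D[OF order.trans[OF A'(2) A(2)]] by (intro emeasure_eq_ennreal_measure) auto
  then have m: "measure lborel A' > 0" using A'(3) by simp
  have "measure lborel A' * q \<le> (LBINT x:A. weight R \<beta> Y x)" if Y: "finite Y" for Y
  proof -
    have "measure lborel A' * q = (LBINT x:A'. q)" using A A' by (subst integral_const) auto
    also have "\<dots> \<le> (LBINT x:A'. weight R \<beta> Y x)"
      using A A' Y by (intro set_integral_mono integrable_bounded_measurable const_meas weight_meas)
        (auto simp: weight_def)
    also have "\<dots> \<le> (LBINT x:A. weight R \<beta> Y x)"
      using A A' Y by (intro integral_nonneg_mono_set(2) weight_meas)
        (auto simp: weight_def intro: less_imp_le[OF \<beta>_pos])
    finally show ?thesis .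
  qed
  then show ?thesis using m A'(4) by (intro exI[of _ "measure lborel A' * q"]) auto
qed

lemma integral_weight_pos: "finite Y \<Longrightarrow> 0 < (LBINT x:D. weight R \<beta> Y x)"
  using integral_weight_ge[of D] pos_D by fastforce

lemma integral_weight_le: "finite Y \<Longrightarrow> (LBINT x:D. weight R \<beta> Y x) \<le> measure lborel D * C"
proof -
  assume Y: "finite Y"
  have "(LBINT x:D. weight R \<beta> Y x) \<le> (LBINT x:D. C)"
    using Y \<beta>_le by (intro set_integral_mono integrable_bounded_measurable const_meas weight_meas)
      (auto simp: weight_def)
  then show ?thesis by (simp add: integral_const)
qed

lemma C_pos: "C > 0"
proof -
  have "D \<noteq> {}" using pos_D by auto
  then show ?thesis using \<beta>_pos \<beta>_le by (meson all_not_in_conv less_le_trans)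
qed

lemma integral_seq_density:
  "(LBINT x:A. seq_density D R \<beta> Y x) = (LBINT x:A. weight R \<beta> Y x) / (LBINT x:D. weight R \<beta> Y x)"
  by (simp add: seq_density_def)

text \<open>The numerator is at least \<open>\<kappa>\<close> and the normalising integral at most
  \<open>measure lborel D * C\<close>, both uniformly in \<open>Y\<close>. This is the source of the
  hitting probability \<delta>, valid for every past.\<close>

lemma integral_seq_density_ge:
  assumes A: "A \<in> sets borel" "A \<subseteq> D" "emeasure lborel A > 0"
  shows "\<exists>\<delta>>0. \<forall>Y. finite Y \<longrightarrow> \<delta> \<le> (LBINT x:A. seq_density D R \<beta> Y x)"
proof -
  obtain \<kappa> where \<kappa>: "\<kappa> > 0" "\<And>Y. finite Y \<Longrightarrow> \<kappa> \<le> (LBINT x:A. weight R \<beta> Y x)"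
    using integral_weight_ge[OF A] by blast
  have "\<kappa> / (measure lborel D * C) \<le> (LBINT x:A. seq_density D R \<beta> Y x)" if "finite Y" for Y
    unfolding integral_seq_density using \<kappa> that integral_weight_pos integral_weight_le
    by (intro frac_le) (auto intro: less_imp_le order.trans)
  then show ?thesis using \<kappa> C_pos volume_D_pos
    by (intro exI[of _ "\<kappa> / (measure lborel D * C)"]) auto
qed

lemma integral_close:
  assumes h: "h \<in> bounded_measurable_on D" and A: "A \<in> sets borel" "A \<subseteq> D" and e: "e \<ge> 0"
    and ae: "AE x in lborel. x \<in> D \<longrightarrow> \<bar>h x - \<beta>lim x\<bar> \<le> e"
  shows "\<bar>(LBINT x:A. h x) - (LBINT x:A. \<beta>lim x)\<bar> \<le> e * measure lborel D"
proof -
  have i: "set_integrable lborel A h" "set_integrable lborel A \<beta>lim"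
    using h A \<beta>lim_meas by (auto intro: integrable_bounded_measurable)
  have ie: "set_integrable lborel A (\<lambda>x. e)"
    using A by (intro integrable_bounded_measurable const_meas)
  have "(LBINT x:A. h x) \<le> (LBINT x:A. \<beta>lim x + e)"
    using i ie ae A by (intro set_integral_mono_AE set_integral_add) (auto elim!: eventually_mono)
  moreover have "(LBINT x:A. \<beta>lim x) \<le> (LBINT x:A. h x + e)"
    using i ie ae A by (intro set_integral_mono_AE set_integral_add) (auto elim!: eventually_mono)
  moreover have "(LBINT x:A. g x + e) = (LBINT x:A. g x) + measure lborel A * e"
    if "set_integrable lborel A g" for g
    using that A ie by (subst set_integral_add) (auto simp: integral_const)
  moreover have "measure lborel A \<le> measure lborel D"
    using A finite_D[of D] by (intro measure_mono_fmeasurable) (auto simp: fmeasurable_def)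
  then have "measure lborel A * e \<le> e * measure lborel D"
    using e by (simp add: mult.commute mult_left_mono)
  ultimately show ?thesis using i by fastforce
qed

text \<open>With enough neighbours almost everywhere, uniform convergence puts the weight near
  \<open>\<beta>lim\<close>, so numerator and normaliser are both near their limits. The threshold
  \<open>L\<close> depends on \<open>e\<close> alone.\<close>

lemma integral_seq_density_close:
  assumes e: "e > 0"
  shows "\<exists>L. \<forall>Y. finite Y \<longrightarrow> (AE x in lborel. x \<in> D \<longrightarrow> L \<le> num_neighbours R x Y) \<longrightarrow>
    (\<forall>A. A \<in> sets borel \<longrightarrow> A \<subseteq> D \<longrightarrow> \<bar>(LBINT x:A. seq_density D R \<beta> Y x) - J A\<bar> \<le> e)"
proof -
  define V T where "V = measure lborel D" and "T = (LBINT x:D. \<beta>lim x)"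
  have V: "V > 0" and T: "T > 0" using volume_D_pos total_pos by (auto simp: V_def T_def)
  \<comment> \<open>Numerator and normaliser each contribute an error of at most
    \<open>e' * V / T\<close>, that is \<open>e / 2\<close>.\<close>
  define e' where "e' = e * T / (2 * V)"
  have e': "e' > 0" using e V T by (simp add: e'_def)
  obtain L where L: "\<And>n x. n \<ge> L \<Longrightarrow> x \<in> D \<Longrightarrow> dist (\<beta> n x) (\<beta>lim x) < e'"
    using uniform_limitD[OF \<beta>_lim e'] by (auto simp: eventually_sequentially)
  show ?thesis
  proof (intro exI[of _ L] allI impI)
    fix Y :: "'a set" and A
    assume Y: "finite Y" and ae: "AE x in lborel. x \<in> D \<longrightarrow> L \<le> num_neighbours R x Y"
      and A: "A \<in> sets borel" "A \<subseteq> D"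
    define W where "W A = (LBINT x:A. weight R \<beta> Y x)" for A
    have ae': "AE x in lborel. x \<in> D \<longrightarrow> \<bar>weight R \<beta> Y x - \<beta>lim x\<bar> \<le> e'"
      using ae by eventually_elim (use L in \<open>force simp: weight_def dist_real_def\<close>)
    have cA: "\<bar>W A - (LBINT x:A. \<beta>lim x)\<bar> \<le> e' * V" and cD: "\<bar>W D - T\<bar> \<le> e' * V"
      unfolding W_def V_def T_def using A Y e' ae'
      by (auto intro!: integral_close weight_meas)
    have WD: "W D > 0" using integral_weight_pos[OF Y] by (simp add: W_def)
    have WA: "0 \<le> W A" "W A \<le> W D"
      using integral_nonneg_mono_set[OF weight_meas[OF Y] A(1) D_borel A(2)] \<beta>_pos
      by (auto simp: W_def weight_def less_imp_le)
    \<comment> \<open>This decomposition divides the two errors by the fixed number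
      \<open>T\<close>; the remaining quotient \<open>W A / W D\<close> lies between 0 and
      1.\<close>
    have "W A / W D - J A = (W A - (LBINT x:A. \<beta>lim x)) / T + W A / W D * ((T - W D) / T)"
      using T WD by (simp add: J_def T_def[symmetric] field_simps)
    also have "\<bar>\<dots>\<bar> \<le> \<bar>W A - (LBINT x:A. \<beta>lim x)\<bar> / T + W A / W D * (\<bar>T - W D\<bar> / T)"
      using T WD WA by (intro order.trans[OF abs_triangle_ineq]) (simp add: abs_mult)
    also have "\<dots> \<le> e' * V / T + 1 * (e' * V / T)"
      using T WD WA cA cD by (intro add_mono divide_right_mono mult_mono) auto
    also have "\<dots> = e" using T V by (simp add: e'_def)
    finally show "\<bar>(LBINT x:A. seq_density D R \<beta> Y x) - J A\<bar> \<le> e"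
      by (simp add: integral_seq_density W_def)
  qed
qed

text \<open>The neighbour condition is replaced by finitely many hitting conditions, whose
  probabilities can be controlled. Points within \<open>r\<close> of \<open>x\<close> are counted by
  \<open>num_neighbours\<close> since \<open>r \<le> R x\<close>.\<close>

lemma integral_seq_density_close_if_hits:
  assumes e: "e > 0"
  shows "\<exists>\<A>. finite \<A> \<and> (\<forall>B\<in>\<A>. B \<in> sets borel \<and> B \<subseteq> D \<and> emeasure lborel B > 0) \<and>
    (\<forall>Y. finite Y \<longrightarrow> (\<forall>B\<in>\<A>. Y \<inter> B \<noteq> {}) \<longrightarrow>
      (\<forall>A. A \<in> sets borel \<longrightarrow> A \<subseteq> D \<longrightarrow> \<bar>(LBINT x:A. seq_density D R \<beta> Y x) - J A\<bar> \<le> e))"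
proof -
  obtain L where L: "\<And>Y A. finite Y \<Longrightarrow> (AE x in lborel. x \<in> D \<longrightarrow> L \<le> num_neighbours R x Y) \<Longrightarrow>
    A \<in> sets borel \<Longrightarrow> A \<subseteq> D \<Longrightarrow> \<bar>(LBINT x:A. seq_density D R \<beta> Y x) - J A\<bar> \<le> e"
    using integral_seq_density_close[OF e] by blast
  obtain \<A> where \<A>: "finite \<A>" "\<forall>A\<in>\<A>. A \<in> sets borel \<and> A \<subseteq> D \<and> emeasure lborel A > 0"
    and ae: "AE x in lborel. x \<in> D \<longrightarrow> (\<forall>Y. finite Y \<longrightarrow> (\<forall>A\<in>\<A>. Y \<inter> A \<noteq> {}) \<longrightarrow>
              L \<le> card {y \<in> Y. dist x y \<le> r})"
    using neighbour_forcing_family[OF compact_D r_pos, of L] by blast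
  have "AE x in lborel. x \<in> D \<longrightarrow> L \<le> num_neighbours R x Y"
    if Y: "finite Y" "\<forall>A\<in>\<A>. Y \<inter> A \<noteq> {}" for Y
    using ae
  proof (eventually_elim, intro impI)
    fix x assume *: "x \<in> D \<longrightarrow> (\<forall>Y. finite Y \<longrightarrow> (\<forall>A\<in>\<A>. Y \<inter> A \<noteq> {}) \<longrightarrow>
              L \<le> card {y \<in> Y. dist x y \<le> r})" "x \<in> D"
    then have "L \<le> card {y \<in> Y. dist x y \<le> r}" using Y by blast
    also have "\<dots> \<le> num_neighbours R x Y"
      unfolding num_neighbours_def using Y R_ge[OF *(2)] by (intro card_mono) auto
    finally show "L \<le> num_neighbours R x Y" .
  qed
  then show ?thesis using \<A> L by (intro exI[of _ \<A>]) auto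
qed

end

section \<open>The random points and their conditional probabilities\<close>

locale interacting_points = interaction D R \<beta> \<beta>lim r b C + prob_space M
  for D :: "'a::euclidean_space set" and R \<beta> \<beta>lim r b C and M :: "'w measure" +
  fixes X :: "nat \<Rightarrow> 'w \<Rightarrow> 'a"
  assumes X: "sequential_points M D R \<beta> X"
begin

abbreviation "hist k \<equiv> history M D X k"

text \<open>A fixed version of the conditional probability that point number \<open>Suc k\<close>
  falls in \<open>A\<close>, given the first \<open>k\<close> points. Its expression through the
  density holds almost surely only.\<close>

definition p :: "nat \<Rightarrow> 'a set \<Rightarrow> 'w \<Rightarrow> real" where
  "p k A = real_cond_exp M (hist k) (indicator (X (Suc k) -` A \<inter> space M))"

lemma X_meas: "i \<ge> 1 \<Longrightarrow> X i \<in> M \<rightarrow>\<^sub>M restrict_space borel D"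
  using X by (auto simp: sequential_points_def)

lemma X_in_D: "i \<ge> 1 \<Longrightarrow> w \<in> space M \<Longrightarrow> X i w \<in> D"
  using measurable_space[OF X_meas] by (simp add: space_restrict_space)

lemma path_meas: "(\<lambda>w. \<lambda>i\<in>{1..k}. X i w) \<in> M \<rightarrow>\<^sub>M (\<Pi>\<^sub>M i\<in>{1..k}. restrict_space borel D)"
  by (intro measurable_restrict X_meas) auto

lemma space_hist[simp]: "space (hist k) = space M"
  by (simp add: history_def)

lemma X_meas_hist:
  assumes "i \<in> {1..k}"
  shows "X i \<in> hist k \<rightarrow>\<^sub>M restrict_space borel D"
proof -
  have "(\<lambda>w. \<lambda>i\<in>{1..k}. X i w) \<in> hist k \<rightarrow>\<^sub>M (\<Pi>\<^sub>M i\<in>{1..k}. restrict_space borel D)"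
    unfolding history_def using measurable_space[OF path_meas] by (intro measurable_vimage_algebra1) auto
  from measurable_compose[OF this measurable_component_singleton[OF assms]]
  show ?thesis using assms by simp
qed

lemma subalgebra_hist: "subalgebra M (hist k)"
proof -
  have "sets (hist k) \<subseteq> sets M"
    unfolding history_def
    by (intro sets_image_in_sets path_meas) simp
  then show ?thesis by (simp add: subalgebra_def)
qed

sublocale hist: finite_measure_subalgebra M "hist k" for k
  by unfold_locales (rule subalgebra_hist)

lemma p_meas[measurable]: "p k A \<in> borel_measurable (hist k)" "p k A \<in> borel_measurable M"
  by (auto simp: p_def)

lemma hit_sets:
  assumes "A \<in> sets borel" "A \<subseteq> D" "i \<in> {1..k}"
  shows "{w \<in> space M. X i w \<in> A} \<in> sets (hist k)"
proof -
  have "X i -` A \<inter> space (hist k) \<in> sets (hist k)"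
    using assms by (intro measurable_sets[OF X_meas_hist]) (auto simp: sets_D)
  then show ?thesis by (simp add: vimage_def Int_def conj_commute)
qed

lemma indicator_X_meas:
  assumes "A \<in> sets borel" "A \<subseteq> D" "i \<ge> 1"
  shows "(\<lambda>w. indicator A (X i w) :: real) \<in> borel_measurable M"
  using assms by (intro measurable_compose[OF X_meas] borel_measurable_indicator) (auto simp: sets_D)

lemma indicator_X_meas_hist:
  assumes "A \<in> sets borel" "A \<subseteq> D" "i \<in> {1..k}"
  shows "(\<lambda>w. indicator A (X i w) :: real) \<in> borel_measurable (hist k)"
  using assms by (intro measurable_compose[OF X_meas_hist] borel_measurable_indicator) (auto simp: sets_D)

lemma p_eq:
  assumes "A \<in> sets borel" "A \<subseteq> D"
  shows "AE w in M. p k A w = (LBINT x:A. seq_density D R \<beta> ((\<lambda>i. X i w) ` {1..k}) x)"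
  using X assms by (simp add: sequential_points_def has_cond_density_def p_def sets_D)

lemma event_meas:
  assumes "A \<in> sets borel" "A \<subseteq> D"
  shows "X (Suc k) -` A \<inter> space M \<in> sets M"
  using assms by (intro measurable_sets[OF X_meas]) (auto simp: sets_D)

lemma integrable_boundedI:
  "h \<in> borel_measurable M \<Longrightarrow> (AE w in M. \<bar>h w\<bar> \<le> c) \<Longrightarrow> integrable M h" for h :: "'w \<Rightarrow> real"
  by (rule integrable_const_bound[where B = c]) auto

lemma integrable_indicator_event: "E \<in> sets M \<Longrightarrow> integrable M (indicator E :: 'w \<Rightarrow> real)"
  by (rule integrable_boundedI[where c = 1]) (auto simp: indicator_def)

lemma p_bounds:
  assumes "A \<in> sets borel" "A \<subseteq> D"
  shows "AE w in M. 0 \<le> p k A w" "AE w in M. p k A w \<le> 1"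
proof -
  have "integrable M (indicator (X (Suc k) -` A \<inter> space M) :: _ \<Rightarrow> real)"
    using event_meas[OF assms] by (rule integrable_indicator_event)
  then show "AE w in M. 0 \<le> p k A w" "AE w in M. p k A w \<le> 1"
    unfolding p_def by (auto intro!: hist.real_cond_exp_ge_c hist.real_cond_exp_le_c simp: indicator_def)
qed

text \<open>A bounded factor known from the past can be taken out of the conditional expectation.
  This is how the indicator of the next point is exchanged for \<open>p k A\<close> under the
  expectation.\<close>

lemma expectation_cond:
  assumes A: "A \<in> sets borel" "A \<subseteq> D" and h: "h \<in> borel_measurable (hist k)"
    and c: "\<And>w. w \<in> space M \<Longrightarrow> \<bar>h w\<bar> \<le> c"
  shows "integrable M (\<lambda>w. h w * p k A w)"
    "expectation (\<lambda>w. h w * indicator A (X (Suc k) w)) = expectation (\<lambda>w. h w * p k A w)"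
proof -
  let ?I = "indicator (X (Suc k) -` A \<inter> space M) :: 'w \<Rightarrow> real"
  have hM: "h \<in> borel_measurable M" using measurable_from_subalg[OF subalgebra_hist h] .
  have IM: "?I \<in> borel_measurable M" using event_meas[OF A] by simp
  have i: "integrable M (\<lambda>w. h w * ?I w)"
  proof (rule integrable_boundedI)
    show "(\<lambda>w. h w * ?I w) \<in> borel_measurable M" by (rule borel_measurable_times[OF hM IM])
    \<comment> \<open>The absolute value of \<open>c\<close> also covers the points where the
      product vanishes, with no separate argument for the sign of \<open>c\<close>.\<close>
    show "AE w in M. \<bar>h w * ?I w\<bar> \<le> \<bar>c\<bar>"
      using AE_space by eventually_elim
        (auto simp: indicator_def intro: order.trans[OF c abs_ge_self])
  qed
  show "integrable M (\<lambda>w. h w * p k A w)"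
    unfolding p_def by (rule hist.real_cond_exp_intg(1)[OF i h IM])
  have "expectation (\<lambda>w. h w * indicator A (X (Suc k) w)) = expectation (\<lambda>w. h w * ?I w)"
    by (intro Bochner_Integration.integral_cong) (auto simp: indicator_def)
  also have "\<dots> = expectation (\<lambda>w. h w * p k A w)"
    unfolding p_def by (rule hist.real_cond_exp_intg(2)[OF i h IM, symmetric])
  finally show "expectation (\<lambda>w. h w * indicator A (X (Suc k) w)) = expectation (\<lambda>w. h w * p k A w)" .
qed

section \<open>Missed sets and convergence of the conditional probabilities\<close>

definition miss :: "nat \<Rightarrow> 'a set \<Rightarrow> 'w set" where
  "miss k A = {w \<in> space M. \<forall>i\<in>{1..k}. X i w \<notin> A}"

lemma miss_sets:
  assumes "A \<in> sets borel" "A \<subseteq> D"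
  shows "miss k A \<in> sets (hist k)"
proof -
  have "miss k A = space (hist k) - (\<Union>i\<in>{1..k}. {w \<in> space M. X i w \<in> A})"
    by (auto simp: miss_def)
  then show ?thesis using hit_sets[OF assms, of _ k] by (auto simp del: space_hist)
qed

lemma prob_miss_tendsto_zero:
  assumes A: "A \<in> sets borel" "A \<subseteq> D" "emeasure lborel A > 0"
  shows "(\<lambda>k. prob (miss k A)) \<longlonglongrightarrow> 0"
proof -
  obtain \<delta> where \<delta>: "\<delta> > 0" "\<And>Y. finite Y \<Longrightarrow> \<delta> \<le> (LBINT x:A. seq_density D R \<beta> Y x)"
    using integral_seq_density_ge[OF A] by blast
  \<comment> \<open>The truncation at 0 makes \<open>q\<close> nonnegative, as the induction on
    powers requires, without first showing that \<delta> is at most 1.\<close>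
  define q where "q = max 0 (1 - \<delta>)"
  have q: "0 \<le> q" "1 - \<delta> \<le> q" "q < 1" using \<delta>(1) by (auto simp: q_def)
  have msM: "miss k A \<in> sets M" for k
    using miss_sets[OF A(1,2), of k] subalgebra_hist[of k] by (auto simp: subalgebra_def)
  have step: "prob (miss (Suc k) A) \<le> q * prob (miss k A)" for k
  proof -
    let ?m = "indicator (miss k A) :: 'w \<Rightarrow> real"
    have m: "?m \<in> borel_measurable (hist k)" using miss_sets[OF A(1,2)] by simp
    have bd: "\<And>w. w \<in> space M \<Longrightarrow> \<bar>?m w\<bar> \<le> 1" by (auto simp: indicator_def)
    \<comment> \<open>To miss \<open>Suc k\<close> times is to miss \<open>k\<close> times, except
      when the next point hits. The subtracted term has a factor from the past and can be
      conditioned.\<close>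
    have ms: "indicator (miss (Suc k) A) w = ?m w - ?m w * indicator A (X (Suc k) w)"
      if "w \<in> space M" for w
      using that by (auto simp: miss_def indicator_def atLeastAtMostSuc_conv)
    have eq: "prob (miss (Suc k) A) = prob (miss k A) - expectation (\<lambda>w. ?m w * p k A w)"
    proof -
      have "prob (miss (Suc k) A) = expectation (\<lambda>w. ?m w - ?m w * indicator A (X (Suc k) w))"
        using msM[of "Suc k"] ms by (subst Bochner_Integration.integral_cong[OF refl ms[symmetric]]) auto
      also have "\<dots> = prob (miss k A) - expectation (\<lambda>w. ?m w * indicator A (X (Suc k) w))"
        using msM[of k] indicator_X_meas[OF A(1,2), of "Suc k"]
        by (subst Bochner_Integration.integral_diff)
          (auto intro!: integrable_boundedI[where c = 1] simp: indicator_def)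
      also have "\<dots> = prob (miss k A) - expectation (\<lambda>w. ?m w * p k A w)"
        by (simp add: expectation_cond(2)[OF A(1,2) m bd])
      finally show ?thesis .
    qed
    have "expectation (\<lambda>w. ?m w * \<delta>) \<le> expectation (\<lambda>w. ?m w * p k A w)"
    proof (rule integral_mono_AE)
      show "integrable M (\<lambda>w. ?m w * p k A w)" by (rule expectation_cond(1)[OF A(1,2) m bd])
      show "AE w in M. ?m w * \<delta> \<le> ?m w * p k A w"
        using p_eq[OF A(1,2), of k] by eventually_elim (simp add: \<delta>(2) mult_left_mono)
    qed (use integrable_indicator_event[OF msM, of k] in auto)
    moreover have "expectation (\<lambda>w. ?m w * \<delta>) = \<delta> * prob (miss k A)"
      using msM[of k] integrable_indicator_event[OF msM, of k] by simp
    ultimately have "prob (miss (Suc k) A) \<le> (1 - \<delta>) * prob (miss k A)"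
      unfolding eq left_diff_distrib by linarith
    also have "\<dots> \<le> q * prob (miss k A)" using q by (intro mult_right_mono) auto
    finally show ?thesis .
  qed
  have "prob (miss k A) \<le> q ^ k" for k
  proof (induction k)
    case (Suc k)
    then show ?case using step[of k] q by (auto intro: order.trans mult_left_mono)
  qed simp
  moreover have "(\<lambda>k. q ^ k) \<longlonglongrightarrow> 0" using q by (intro LIMSEQ_realpow_zero) auto
  ultimately show ?thesis
    by (intro tendsto_sandwich[OF _ _ tendsto_const[of 0] \<open>(\<lambda>k. q ^ k) \<longlonglongrightarrow> 0\<close>]) auto
qed

text \<open>By the tower property, the covariance of \<open>indicator A (X (Suc m))\<close> with the centred sum over
  the past is at most \<open>m * \<eta> A m\<close>, so no martingale decomposition is needed.\<close>

definition \<eta> :: "'a set \<Rightarrow> nat \<Rightarrow> real" where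
  "\<eta> A k = expectation (\<lambda>w. \<bar>p k A w - J A\<bar>)"

lemma p_close:
  assumes A: "A \<in> sets borel" "A \<subseteq> D"
  shows "AE w in M. \<bar>p k A w - J A\<bar> \<le> 1"
  using p_bounds[OF A, of k] by eventually_elim (use J_bounds[OF A] in auto)

text \<open>If every set of the forcing family has been hit, the deviation is at most
  \<open>e / 2\<close>. Otherwise it is at most 1, on an event whose probability is bounded by the
  sum of finitely many miss probabilities, each tending to 0.\<close>

lemma \<eta>_tendsto_zero:
  assumes A: "A \<in> sets borel" "A \<subseteq> D"
  shows "\<eta> A \<longlonglongrightarrow> 0"
proof (rule LIMSEQ_I)
  fix e :: real assume e: "e > 0"
  obtain \<A> where \<A>: "finite \<A>" "\<And>B. B \<in> \<A> \<Longrightarrow> B \<in> sets borel \<and> B \<subseteq> D \<and> emeasure lborel B > 0"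
    and close: "\<And>Y. finite Y \<Longrightarrow> \<forall>B\<in>\<A>. Y \<inter> B \<noteq> {} \<Longrightarrow>
       \<bar>(LBINT x:A. seq_density D R \<beta> Y x) - J A\<bar> \<le> e / 2"
    using integral_seq_density_close_if_hits[OF half_gt_zero[OF e]] A by metis
  have msM: "miss k B \<in> sets M" if "B \<in> \<A>" for k B
    using miss_sets[of B k] \<A>(2)[OF that] subalgebra_hist[of k] by (auto simp: subalgebra_def)
  have int: "integrable M (\<lambda>w. \<bar>p k A w - J A\<bar>)" for k
    using p_close[OF A, of k] by (intro integrable_boundedI[where c = 1]) auto
  have bound: "\<eta> A k \<le> e / 2 + (\<Sum>B\<in>\<A>. prob (miss k B))" for k
  proof -
    have "\<eta> A k \<le> expectation (\<lambda>w. e / 2 + (\<Sum>B\<in>\<A>. indicator (miss k B) w))"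
      unfolding \<eta>_def
    proof (rule integral_mono_AE[OF int])
      show "integrable M (\<lambda>w. e / 2 + (\<Sum>B\<in>\<A>. indicator (miss k B) w :: real))"
        using msM by (intro Bochner_Integration.integrable_add Bochner_Integration.integrable_sum
            integrable_indicator_event) auto
      show "AE w in M. \<bar>p k A w - J A\<bar> \<le> e / 2 + (\<Sum>B\<in>\<A>. indicator (miss k B) w)"
        using p_eq[OF A, of k] p_close[OF A, of k] AE_space
      proof eventually_elim
        fix w assume w: "p k A w = (LBINT x:A. seq_density D R \<beta> ((\<lambda>i. X i w) ` {1..k}) x)"
          "\<bar>p k A w - J A\<bar> \<le> 1" "w \<in> space M"
        have nn: "0 \<le> (\<Sum>B\<in>\<A>. indicator (miss k B) w :: real)" by (intro sum_nonneg) auto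
        show "\<bar>p k A w - J A\<bar> \<le> e / 2 + (\<Sum>B\<in>\<A>. indicator (miss k B) w)"
        proof (cases "\<exists>B\<in>\<A>. w \<in> miss k B")
          case True
          then obtain B where B: "B \<in> \<A>" "w \<in> miss k B" by blast
          have "(1::real) = indicator (miss k B) w" using B by simp
          also have "\<dots> \<le> (\<Sum>B\<in>\<A>. indicator (miss k B) w)"
            using B \<A>(1) by (intro member_le_sum) auto
          finally show ?thesis using w(2) e by simp
        next
          case False
          then have "\<forall>B\<in>\<A>. (\<lambda>i. X i w) ` {1..k} \<inter> B \<noteq> {}" using w(3) by (auto simp: miss_def)
          from close[OF _ this] show ?thesis using w(1) nn by auto
        qed
      qed
    qed
    also have "\<dots> = e / 2 + (\<Sum>B\<in>\<A>. prob (miss k B))"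
      using msM integrable_indicator_event[OF msM]
      by (simp add: prob_space Bochner_Integration.integral_sum)
    finally show ?thesis .
  qed
  have "(\<lambda>k. \<Sum>B\<in>\<A>. prob (miss k B)) \<longlonglongrightarrow> (\<Sum>B\<in>\<A>. 0)"
    using \<A>(2) by (intro tendsto_sum prob_miss_tendsto_zero) auto
  then obtain N where N: "\<And>k. k \<ge> N \<Longrightarrow> (\<Sum>B\<in>\<A>. prob (miss k B)) < e / 2"
    using e LIMSEQ_D[of "\<lambda>k. \<Sum>B\<in>\<A>. prob (miss k B)" 0 "e / 2"] by force
  have "0 \<le> \<eta> A k" for k unfolding \<eta>_def by simp
  then show "\<exists>N. \<forall>k\<ge>N. norm (\<eta> A k - 0) < e"
    using N bound by (intro exI[of _ N]) (fastforce intro: le_less_trans)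
qed

section \<open>Second moments of the centred counts\<close>

definition S :: "'a set \<Rightarrow> nat \<Rightarrow> 'w \<Rightarrow> real" where
  "S A m w = (\<Sum>i=1..m. indicator A (X i w) - J A)"

lemma S_meas:
  assumes A: "A \<in> sets borel" "A \<subseteq> D"
  shows "S A m \<in> borel_measurable (hist m)" "S A m \<in> borel_measurable M"
proof -
  show "S A m \<in> borel_measurable (hist m)"
    unfolding S_def[abs_def] using indicator_X_meas_hist[OF A, of _ m]
    by (intro borel_measurable_sum borel_measurable_diff) auto
  then show "S A m \<in> borel_measurable M" by (rule measurable_from_subalg[OF subalgebra_hist])
qed

lemma centred_indicator_bound: "A \<in> sets borel \<Longrightarrow> A \<subseteq> D \<Longrightarrow> \<bar>indicator A x - J A\<bar> \<le> 1"
  using J_bounds[of A] by (auto simp: indicator_def)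

lemma S_bound:
  assumes "A \<in> sets borel" "A \<subseteq> D" shows "\<bar>S A m w\<bar> \<le> real m"
proof -
  have "\<bar>S A m w\<bar> \<le> (\<Sum>i=1..m. 1)"
    unfolding S_def by (intro order.trans[OF sum_abs] sum_mono centred_indicator_bound assms)
  then show ?thesis by simp
qed

lemma S_integrable:
  assumes A: "A \<in> sets borel" "A \<subseteq> D"
  shows "integrable M (S A m)" "integrable M (\<lambda>w. (S A m w)\<^sup>2)"
proof -
  show "integrable M (S A m)"
    using S_bound[OF A] by (intro integrable_boundedI[where c = m] S_meas A) auto
  have "\<bar>(S A m w)\<^sup>2\<bar> \<le> (real m)\<^sup>2" for w
    using S_bound[OF A, of m w] by (simp add: abs_le_square_iff[symmetric])
  then show "integrable M (\<lambda>w. (S A m w)\<^sup>2)"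
    using S_meas[OF A] by (intro integrable_boundedI[where c = "(real m)\<^sup>2"]) auto
qed

text \<open>In the expanded square of \<open>S A m + Y\<close>, the last square is at most 1.
  Conditioning on the past turns \<open>Y\<close> in the cross term into \<open>p m A - J A\<close>,
  and the other factor is at most \<open>m\<close> in absolute value.\<close>

lemma second_moment_step:
  assumes A: "A \<in> sets borel" "A \<subseteq> D"
  shows "expectation (\<lambda>w. (S A (Suc m) w)\<^sup>2)
    \<le> expectation (\<lambda>w. (S A m w)\<^sup>2) + 2 * (real m * \<eta> A m) + 1"
proof -
  define Y where "Y w = indicator A (X (Suc m) w) - J A" for w
  have Y: "Y \<in> borel_measurable M" "\<And>w. \<bar>Y w\<bar> \<le> 1"
    unfolding Y_def[abs_def] using indicator_X_meas[OF A, of "Suc m"] centred_indicator_bound[OF A] by auto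
  have Y2: "(Y w)\<^sup>2 \<le> 1" for w using Y(2)[of w] by (simp add: abs_square_le_1)
  have SY: "\<bar>S A m w * Y w\<bar> \<le> real m" for w
    using mult_mono[OF S_bound[OF A, of m w] Y(2)[of w]] by (simp add: abs_mult)
  have iSY: "integrable M (\<lambda>w. S A m w * Y w)"
    using SY Y(1) S_meas[OF A] by (intro integrable_boundedI[where c = m]) auto
  have iY2: "integrable M (\<lambda>w. (Y w)\<^sup>2)"
    using Y2 Y(1) by (intro integrable_boundedI[where c = 1]) auto
  have iSI: "integrable M (\<lambda>w. S A m w * indicator A (X (Suc m) w))"
    using S_bound[OF A, of m] indicator_X_meas[OF A, of "Suc m"] S_meas[OF A]
    by (intro integrable_boundedI[where c = m]) (auto simp: indicator_def)
  note ec = expectation_cond[OF A S_meas(1)[OF A] S_bound[OF A]]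
  have "(S A (Suc m) w)\<^sup>2 = (S A m w)\<^sup>2 + 2 * (S A m w * Y w) + (Y w)\<^sup>2" for w
    by (simp add: S_def Y_def power2_eq_square algebra_simps)
  then have "expectation (\<lambda>w. (S A (Suc m) w)\<^sup>2)
    = expectation (\<lambda>w. (S A m w)\<^sup>2) + 2 * expectation (\<lambda>w. S A m w * Y w) + expectation (\<lambda>w. (Y w)\<^sup>2)"
    using S_integrable[OF A] iSY iY2 by simp
  moreover have "expectation (\<lambda>w. (Y w)\<^sup>2) \<le> expectation (\<lambda>w. 1)"
    using iY2 Y2 by (intro integral_mono) auto
  moreover have "expectation (\<lambda>w. S A m w * Y w) \<le> real m * \<eta> A m"
  proof -
    have "expectation (\<lambda>w. S A m w * Y w)
        = expectation (\<lambda>w. S A m w * indicator A (X (Suc m) w)) - expectation (\<lambda>w. S A m w * J A)"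
      unfolding Y_def right_diff_distrib using iSI S_integrable(1)[OF A]
      by (intro Bochner_Integration.integral_diff) auto
    also have "\<dots> = expectation (\<lambda>w. S A m w * (p m A w - J A))"
      unfolding right_diff_distrib ec(2) using ec(1) S_integrable(1)[OF A]
      by (intro Bochner_Integration.integral_diff[symmetric]) auto
    also have "\<dots> \<le> expectation (\<lambda>w. real m * \<bar>p m A w - J A\<bar>)"
    proof (rule integral_mono)
      show "integrable M (\<lambda>w. S A m w * (p m A w - J A))"
        unfolding right_diff_distrib using ec(1) S_integrable(1)[OF A] by auto
      show "integrable M (\<lambda>w. real m * \<bar>p m A w - J A\<bar>)"
        using p_close[OF A, of m]
        by (intro Bochner_Integration.integrable_mult_right integrable_boundedI[where c = 1]) auto
      show "S A m w * (p m A w - J A) \<le> real m * \<bar>p m A w - J A\<bar>" for w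
      proof -
        have "S A m w * (p m A w - J A) \<le> \<bar>S A m w\<bar> * \<bar>p m A w - J A\<bar>"
          by (metis abs_ge_self abs_mult)
        also have "\<dots> \<le> real m * \<bar>p m A w - J A\<bar>"
          using S_bound[OF A] by (intro mult_right_mono) auto
        finally show ?thesis .
      qed
    qed
    also have "\<dots> = real m * \<eta> A m" by (simp add: \<eta>_def)
    finally show ?thesis .
  qed
  ultimately show ?thesis by (simp add: prob_space)
qed

lemma \<eta>_nonneg: "0 \<le> \<eta> A k"
  by (simp add: \<eta>_def)

text \<open>The separate bound \<open>n\<close> keeps the coefficient of the sum fixed during the
  induction on \<open>m\<close>; it is later taken equal to \<open>m\<close>.\<close>

lemma second_moment_le:
  assumes A: "A \<in> sets borel" "A \<subseteq> D" and "m \<le> n"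
  shows "expectation (\<lambda>w. (S A m w)\<^sup>2) \<le> 2 * real n * (\<Sum>k<m. \<eta> A k) + real m"
  using \<open>m \<le> n\<close>
proof (induction m)
  case 0
  show ?case by (simp add: S_def)
next
  case (Suc m)
  have "real m * \<eta> A m \<le> real n * \<eta> A m"
    using Suc.prems \<eta>_nonneg by (intro mult_right_mono) auto
  then show ?case using Suc second_moment_step[OF A, of m] by (simp add: algebra_simps)
qed

text \<open>Divided by the square of \<open>m\<close>, the second moment is at most twice a Cesaro
  mean of \<eta> plus \<open>1 / m\<close>. The first moment is kept, as it behaves well under
  finite linear combinations by the triangle inequality.\<close>

lemma mean_deviation_tendsto_zero:
  assumes A: "A \<in> sets borel" "A \<subseteq> D"
  shows "(\<lambda>m. expectation (\<lambda>w. \<bar>S A m w\<bar>) / real m) \<longlonglongrightarrow> 0"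
proof -
  define u where "u m = 2 * ((\<Sum>k<m. \<eta> A k) / real m) + 1 / real m" for m
  have "u \<longlonglongrightarrow> 2 * 0 + 0"
    unfolding u_def[abs_def] by (intro tendsto_intros cesaro_tendsto_zero \<eta>_tendsto_zero A lim_1_over_n)
  then have "(\<lambda>m. sqrt (u m)) \<longlonglongrightarrow> sqrt 0" by (intro tendsto_real_sqrt) simp
  then have lim: "(\<lambda>m. sqrt (u m)) \<longlonglongrightarrow> 0" by simp
  have "expectation (\<lambda>w. \<bar>S A m w\<bar>) / real m \<le> sqrt (u m)" if m: "m \<ge> 1" for m
  proof (rule real_le_rsqrt)
    \<comment> \<open>Nonnegativity of the variance is the inequality between the squared first
      moment and the second moment.\<close>
    have "0 \<le> variance (\<lambda>w. \<bar>S A m w\<bar>)" by (rule variance_positive)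
    also have "\<dots> = expectation (\<lambda>w. \<bar>S A m w\<bar>\<^sup>2) - (expectation (\<lambda>w. \<bar>S A m w\<bar>))\<^sup>2"
      using S_integrable[OF A] by (intro variance_eq) auto
    finally have "(expectation (\<lambda>w. \<bar>S A m w\<bar>))\<^sup>2 \<le> 2 * real m * (\<Sum>k<m. \<eta> A k) + real m"
      using second_moment_le[OF A order.refl, of m] by simp
    then have "(expectation (\<lambda>w. \<bar>S A m w\<bar>))\<^sup>2 / (real m)\<^sup>2
      \<le> (2 * real m * (\<Sum>k<m. \<eta> A k) + real m) / (real m)\<^sup>2"
      by (rule divide_right_mono) simp
    also have "\<dots> = u m" using m by (simp add: u_def power2_eq_square field_simps)
    finally show "(expectation (\<lambda>w. \<bar>S A m w\<bar>) / real m)\<^sup>2 \<le> u m" by (simp add: power_divide)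
  qed
  then show ?thesis
    by (intro tendsto_sandwich[OF _ _ tendsto_const[of 0] lim])
      (auto simp: eventually_sequentially intro: exI[of _ 1])
qed

end

section \<open>From indicators to bounded functions\<close>

lemma bounded_measurable_on_mult:
  assumes "f \<in> bounded_measurable_on D" "g \<in> bounded_measurable_on D"
  shows "(\<lambda>x. f x * g x) \<in> bounded_measurable_on D"
proof -
  obtain a b where "\<And>x. x \<in> D \<Longrightarrow> \<bar>f x\<bar> \<le> a" "\<And>x. x \<in> D \<Longrightarrow> \<bar>g x\<bar> \<le> b"
    using assms by (auto simp: bounded_measurable_on_def bounded_iff)
  then have "\<bar>f x * g x\<bar> \<le> a * b" if "x \<in> D" for x
    using that unfolding abs_mult by (intro mult_mono) (auto intro: order.trans[OF abs_ge_zero])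
  then have "bounded ((\<lambda>x. f x * g x) ` D)" by (intro boundedI[of _ "a * b"]) auto
  then show ?thesis using assms by (auto simp: bounded_measurable_on_def)
qed

lemma converges_in_probability_cong:
  assumes "\<And>m w. w \<in> space M \<Longrightarrow> Z m w = Z' m w"
  shows "converges_in_probability M Z L \<longleftrightarrow> converges_in_probability M Z' L"
proof -
  have "Z m \<in> borel_measurable M \<longleftrightarrow> Z' m \<in> borel_measurable M" for m
    using assms by (intro measurable_cong)
  moreover have "{w \<in> space M. \<bar>Z m w - L w\<bar> > \<epsilon>} = {w \<in> space M. \<bar>Z' m w - L w\<bar> > \<epsilon>}" for m \<epsilon>
    using assms by auto
  ultimately show ?thesis by (simp add: converges_in_probability_def)
qed

text \<open>The pieces are the level sets of the floor of \<open>f x / e\<close>, on which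
  \<open>f\<close> varies by at most \<open>e\<close>. Boundedness of \<open>f\<close> leaves
  finitely many levels, indexed by integers.\<close>

lemma simple_approximation:
  fixes D :: "'a::euclidean_space set"
  assumes f: "f \<in> bounded_measurable_on D" and e: "e > 0"
  obtains I :: "int set" and c A where "finite I" "\<And>k. k \<in> I \<Longrightarrow> A k \<in> sets (restrict_space borel D)"
    "\<And>x. x \<in> D \<Longrightarrow> \<bar>f x - (\<Sum>k\<in>I. c k * indicator (A k) x)\<bar> \<le> e"
proof -
  define A where "A k = {x \<in> space (restrict_space borel D). \<lfloor>f x / e\<rfloor> = k}" for k
  have [measurable]: "f \<in> borel_measurable (restrict_space borel D)"
    using f by (simp add: bounded_measurable_on_def)
  obtain B where B: "\<And>x. x \<in> D \<Longrightarrow> \<bar>f x\<bar> \<le> B"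
    using f by (auto simp: bounded_measurable_on_def bounded_iff)
  define I where "I = {\<lfloor>- B / e\<rfloor>..\<lfloor>B / e\<rfloor>}"
  show thesis
  proof (rule that[of I A "\<lambda>k. e * of_int k"])
    show "A k \<in> sets (restrict_space borel D)" for k unfolding A_def by measurable
    fix x assume x: "x \<in> D"
    define n where "n = \<lfloor>f x / e\<rfloor>"
    have "- B / e \<le> f x / e" "f x / e \<le> B / e"
      using B[OF x] divide_right_mono[of "- B" "f x" e] divide_right_mono[of "f x" B e] e by auto
    then have "n \<in> I" by (auto simp: I_def n_def intro: floor_mono)
    have "(\<Sum>k\<in>I. e * of_int k * indicator (A k) x) = (\<Sum>k\<in>I. if k = n then e * of_int n else 0)"
      using x by (intro sum.cong) (auto simp: A_def n_def space_restrict_space)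
    also have "\<dots> = e * of_int n" using \<open>n \<in> I\<close> by (simp add: I_def)
    finally have *: "(\<Sum>k\<in>I. e * of_int k * indicator (A k) x) = e * of_int n" .
    have "of_int n \<le> f x / e" "f x / e \<le> of_int n + 1" unfolding n_def by linarith+
    then have "e * of_int n \<le> f x" "f x \<le> e * of_int n + e"
      using e by (simp_all add: field_simps)
    then show "\<bar>f x - (\<Sum>k\<in>I. e * of_int k * indicator (A k) x)\<bar> \<le> e" unfolding * by linarith
  qed (simp add: I_def)
qed

context interacting_points
begin

definition mean :: "('a \<Rightarrow> real) \<Rightarrow> real" where
  "mean f = (LBINT x:D. f x * \<beta>lim x) / (LBINT x:D. \<beta>lim x)"

lemma indicator_bounded_measurable: "A \<in> sets borel \<Longrightarrow> A \<subseteq> D \<Longrightarrow> indicator A \<in> bounded_measurable_on D"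
  by (auto simp: bounded_measurable_on_def sets_D intro!: borel_measurable_indicator boundedI[of _ 1])

lemma mean_simple:
  assumes "finite I" "\<And>k. k \<in> I \<Longrightarrow> A k \<in> sets borel \<and> A k \<subseteq> D"
  shows "mean (\<lambda>x. \<Sum>k\<in>I. c k * indicator (A k) x) = (\<Sum>k\<in>I. c k * J (A k))"
    "set_integrable lborel D (\<lambda>x. (\<Sum>k\<in>I. c k * indicator (A k) x) * \<beta>lim x)"
proof -
  have i: "set_integrable lborel D (\<lambda>x. c k * (indicator (A k) x * \<beta>lim x))" if "k \<in> I" for k
    using assms that
    by (intro set_integrable_mult_right integrable_bounded_measurable bounded_measurable_on_mult
        indicator_bounded_measurable \<beta>lim_meas) auto
  have eq: "(\<Sum>k\<in>I. c k * indicator (A k) x) * \<beta>lim x = (\<Sum>k\<in>I. c k * (indicator (A k) x * \<beta>lim x))" for x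
    by (simp add: sum_distrib_right mult.assoc)
  show "set_integrable lborel D (\<lambda>x. (\<Sum>k\<in>I. c k * indicator (A k) x) * \<beta>lim x)"
    unfolding eq set_integrable_def scaleR_sum_right using i
    by (intro Bochner_Integration.integrable_sum) (simp only: set_integrable_def)
  have "(LBINT x:D. (\<Sum>k\<in>I. c k * indicator (A k) x) * \<beta>lim x)
      = (\<Sum>k\<in>I. LBINT x:D. c k * (indicator (A k) x * \<beta>lim x))"
    unfolding eq set_lebesgue_integral_def scaleR_sum_right using i
    by (intro Bochner_Integration.integral_sum) (simp only: set_integrable_def)
  also have "\<dots> = (\<Sum>k\<in>I. c k * (LBINT x:A k. \<beta>lim x))"
  proof (intro sum.cong refl)
    fix k assume "k \<in> I"
    then have "A k \<subseteq> D" using assms by auto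
    then have "(LBINT x:D. indicator (A k) x * \<beta>lim x) = (LBINT x:A k. \<beta>lim x)"
      unfolding set_lebesgue_integral_def
      by (intro Bochner_Integration.integral_cong) (auto simp: indicator_def)
    then show "(LBINT x:D. c k * (indicator (A k) x * \<beta>lim x)) = c k * (LBINT x:A k. \<beta>lim x)"
      by simp
  qed
  finally show "mean (\<lambda>x. \<Sum>k\<in>I. c k * indicator (A k) x) = (\<Sum>k\<in>I. c k * J (A k))"
    by (simp add: mean_def J_def sum_divide_distrib)
qed

text \<open>The functional integrates against a nonnegative density of total mass 1, so it does not
  increase uniform distances on \<open>D\<close>.\<close>

lemma mean_close:
  assumes f: "set_integrable lborel D (\<lambda>x. f x * \<beta>lim x)" and g: "set_integrable lborel D (\<lambda>x. g x * \<beta>lim x)"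
    and e: "\<And>x. x \<in> D \<Longrightarrow> \<bar>f x - g x\<bar> \<le> e"
  shows "\<bar>mean f - mean g\<bar> \<le> e"
proof -
  let ?T = "LBINT x:D. \<beta>lim x"
  have b: "set_integrable lborel D (\<lambda>x. e * \<beta>lim x)"
    by (intro set_integrable_mult_right integrable_bounded_measurable \<beta>lim_meas) auto
  have fg: "f x * \<beta>lim x \<le> g x * \<beta>lim x + e * \<beta>lim x" "g x * \<beta>lim x \<le> f x * \<beta>lim x + e * \<beta>lim x"
    if "x \<in> D" for x
    using mult_right_mono[OF _ \<beta>lim_nonneg[OF that], of "f x" "g x + e"]
      mult_right_mono[OF _ \<beta>lim_nonneg[OF that], of "g x" "f x + e"] e[OF that]
    by (auto simp: abs_le_iff algebra_simps)
  have "(LBINT x:D. f x * \<beta>lim x) \<le> (LBINT x:D. g x * \<beta>lim x + e * \<beta>lim x)"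
    using f g b fg(1) by (intro set_integral_mono set_integral_add)
  moreover have "(LBINT x:D. g x * \<beta>lim x) \<le> (LBINT x:D. f x * \<beta>lim x + e * \<beta>lim x)"
    using f g b fg(2) by (intro set_integral_mono set_integral_add)
  ultimately have "\<bar>(LBINT x:D. f x * \<beta>lim x) - (LBINT x:D. g x * \<beta>lim x)\<bar> \<le> e * ?T"
    using f g b by (simp add: set_integral_add abs_le_iff)
  then show ?thesis
    using total_pos by (simp add: mean_def diff_divide_distrib[symmetric] divide_le_eq)
qed

lemma f_X_meas: "f \<in> bounded_measurable_on D \<Longrightarrow> i \<ge> 1 \<Longrightarrow> (\<lambda>w. f (X i w)) \<in> borel_measurable M"
  by (rule measurable_compose[OF X_meas]) (auto simp: bounded_measurable_on_def)

definition dev :: "('a \<Rightarrow> real) \<Rightarrow> nat \<Rightarrow> 'w \<Rightarrow> real" where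
  "dev f m w = (\<Sum>i=1..m. f (X i w)) - real m * mean f"

lemma dev_meas: "f \<in> bounded_measurable_on D \<Longrightarrow> dev f m \<in> borel_measurable M"
  unfolding dev_def[abs_def] by (intro borel_measurable_diff borel_measurable_sum borel_measurable_const) (auto intro: f_X_meas)

lemma dev_integrable:
  assumes "f \<in> bounded_measurable_on D"
  shows "integrable M (dev f m)"
proof -
  obtain B where B: "\<And>x. x \<in> D \<Longrightarrow> \<bar>f x\<bar> \<le> B"
    using assms by (auto simp: bounded_measurable_on_def bounded_iff)
  have "integrable M (\<lambda>w. f (X i w))" if "i \<in> {1..m}" for i
  proof (rule integrable_boundedI)
    show "AE w in M. \<bar>f (X i w)\<bar> \<le> B"
      using that by (intro AE_I2 B X_in_D) auto
  qed (use that in \<open>auto intro: f_X_meas assms\<close>)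
  then show ?thesis
    unfolding dev_def[abs_def]
    by (intro Bochner_Integration.integrable_diff Bochner_Integration.integrable_sum) auto
qed

text \<open>The simple function \<open>s\<close> is fixed before \<open>m\<close> grows. Replacing
  \<open>f\<close> by \<open>s\<close> costs \<open>e / 4\<close> per point and \<open>e / 4\<close>
  in the mean; what remains is a fixed finite combination of centred counts, which is negligible
  relative to \<open>m\<close>.\<close>

lemma mean_abs_dev_tendsto_zero:
  assumes f: "f \<in> bounded_measurable_on D"
  shows "(\<lambda>m. expectation (\<lambda>w. \<bar>dev f m w\<bar>) / real m) \<longlonglongrightarrow> 0"
proof (rule LIMSEQ_I)
  fix e :: real assume e: "e > 0"
  have e4: "e / 4 > 0" using e by simp
  obtain I :: "int set" and c A where I: "finite I"
    and A0: "\<And>k. k \<in> I \<Longrightarrow> A k \<in> sets (restrict_space borel D)"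
    and app: "\<And>x. x \<in> D \<Longrightarrow> \<bar>f x - (\<Sum>k\<in>I. c k * indicator (A k) x)\<bar> \<le> e / 4"
    by (rule simple_approximation[OF f e4]) (rule that)
  have A: "A k \<in> sets borel" "A k \<subseteq> D" if "k \<in> I" for k using A0[OF that] by (simp_all add: sets_D)
  define s where "s x = (\<Sum>k\<in>I. c k * indicator (A k) x)" for x
  have "\<bar>mean f - mean s\<bar> \<le> e / 4"
  proof (rule mean_close)
    show "set_integrable lborel D (\<lambda>x. f x * \<beta>lim x)"
      by (intro integrable_bounded_measurable bounded_measurable_on_mult f \<beta>lim_meas) auto
    show "set_integrable lborel D (\<lambda>x. s x * \<beta>lim x)"
      unfolding s_def using A by (intro mean_simple(2) I) auto
  qed (use app in \<open>simp add: s_def\<close>)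
  note mean = this
  have dev_s: "(\<Sum>i=1..m. s (X i w)) - real m * mean s = (\<Sum>k\<in>I. c k * S (A k) m w)" for m w
  proof -
    have "(\<Sum>i=1..m. s (X i w)) = (\<Sum>k\<in>I. c k * (\<Sum>i=1..m. indicator (A k) (X i w)))"
      unfolding s_def by (subst sum.swap) (simp add: sum_distrib_left)
    moreover have "mean s = (\<Sum>k\<in>I. c k * J (A k))"
      unfolding s_def[abs_def] using A by (intro mean_simple(1) I) auto
    ultimately show ?thesis
      by (simp add: S_def sum_subtractf sum_distrib_left right_diff_distrib mult_ac)
  qed
  have pw: "\<bar>dev f m w\<bar> \<le> real m * (e / 2) + (\<Sum>k\<in>I. \<bar>c k\<bar> * \<bar>S (A k) m w\<bar>)" if w: "w \<in> space M" for m w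
  proof -
    have "\<bar>\<Sum>i=1..m. f (X i w) - s (X i w)\<bar> \<le> (\<Sum>i=1..m. e / 4)"
      using app X_in_D w by (intro order.trans[OF sum_abs] sum_mono) (auto simp: s_def)
    then have 1: "\<bar>\<Sum>i=1..m. f (X i w) - s (X i w)\<bar> \<le> real m * (e / 4)" by simp
    have "\<bar>real m * (mean s - mean f)\<bar> = real m * \<bar>mean f - mean s\<bar>"
      by (simp add: abs_mult abs_minus_commute)
    also have "\<dots> \<le> real m * (e / 4)" using mean by (intro mult_left_mono) auto
    finally have 2: "\<bar>real m * (mean s - mean f)\<bar> \<le> real m * (e / 4)" .
    have 3: "\<bar>\<Sum>k\<in>I. c k * S (A k) m w\<bar> \<le> (\<Sum>k\<in>I. \<bar>c k\<bar> * \<bar>S (A k) m w\<bar>)"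
      by (rule order.trans[OF sum_abs]) (simp add: abs_mult)
    have "dev f m w = (\<Sum>i=1..m. f (X i w) - s (X i w)) + (\<Sum>k\<in>I. c k * S (A k) m w)
        + real m * (mean s - mean f)"
      unfolding dev_s[symmetric] dev_def by (simp add: sum_subtractf algebra_simps)
    then show ?thesis using 1 2 3 by linarith
  qed
  have bound: "expectation (\<lambda>w. \<bar>dev f m w\<bar>) / real m
      \<le> e / 2 + (\<Sum>k\<in>I. \<bar>c k\<bar> * (expectation (\<lambda>w. \<bar>S (A k) m w\<bar>) / real m))" if m: "m \<ge> 1" for m
  proof -
    have iS: "integrable M (\<lambda>w. \<bar>c k\<bar> * \<bar>S (A k) m w\<bar>)" if "k \<in> I" for k
      using S_integrable(1)[OF A[OF that]] by auto
    have "expectation (\<lambda>w. \<bar>dev f m w\<bar>)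
        \<le> expectation (\<lambda>w. real m * (e / 2) + (\<Sum>k\<in>I. \<bar>c k\<bar> * \<bar>S (A k) m w\<bar>))"
      using pw iS dev_integrable[OF f]
      by (intro integral_mono Bochner_Integration.integrable_add Bochner_Integration.integrable_sum) auto
    also have "\<dots> = real m * (e / 2) + (\<Sum>k\<in>I. \<bar>c k\<bar> * expectation (\<lambda>w. \<bar>S (A k) m w\<bar>))"
      using iS by (simp add: Bochner_Integration.integral_sum prob_space)
    finally have "expectation (\<lambda>w. \<bar>dev f m w\<bar>) / real m
       \<le> (real m * (e / 2) + (\<Sum>k\<in>I. \<bar>c k\<bar> * expectation (\<lambda>w. \<bar>S (A k) m w\<bar>))) / real m"
      by (rule divide_right_mono) simp
    also have "\<dots> = e / 2 + (\<Sum>k\<in>I. \<bar>c k\<bar> * (expectation (\<lambda>w. \<bar>S (A k) m w\<bar>) / real m))"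
      using m by (simp add: add_divide_distrib sum_divide_distrib)
    finally show ?thesis .
  qed
  have "(\<lambda>m. \<Sum>k\<in>I. \<bar>c k\<bar> * (expectation (\<lambda>w. \<bar>S (A k) m w\<bar>) / real m)) \<longlonglongrightarrow> (\<Sum>k\<in>I. \<bar>c k\<bar> * 0)"
    using A by (intro tendsto_sum tendsto_mult_left mean_deviation_tendsto_zero)
  then have "\<forall>\<^sub>F m in sequentially. (\<Sum>k\<in>I. \<bar>c k\<bar> * (expectation (\<lambda>w. \<bar>S (A k) m w\<bar>) / real m)) < e / 2"
    using e by (intro order_tendstoD(2)[where y = 0]) auto
  then obtain N where N: "\<And>m. m \<ge> N \<Longrightarrow>
      (\<Sum>k\<in>I. \<bar>c k\<bar> * (expectation (\<lambda>w. \<bar>S (A k) m w\<bar>) / real m)) < e / 2"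
    unfolding eventually_sequentially by blast
  show "\<exists>N. \<forall>m\<ge>N. norm (expectation (\<lambda>w. \<bar>dev f m w\<bar>) / real m - 0) < e"
  proof (intro exI[of _ "max 1 N"] allI impI)
    fix m assume m: "m \<ge> max 1 N"
    then have "expectation (\<lambda>w. \<bar>dev f m w\<bar>) / real m < e" using bound[of m] N[of m] by auto
    moreover have "0 \<le> expectation (\<lambda>w. \<bar>dev f m w\<bar>) / real m" by simp
    ultimately show "norm (expectation (\<lambda>w. \<bar>dev f m w\<bar>) / real m - 0) < e" by simp
  qed
qed

text \<open>Markov's inequality, applied to the absolute deviation at level
  \<open>\<epsilon> * m\<close>, turns convergence in mean into convergence in probability.\<close>

lemma weak_law:
  assumes f: "f \<in> bounded_measurable_on D"
  shows "converges_in_probability M (\<lambda>m w. 1 / real m * (\<Sum>i=1..m. f (X i w))) (\<lambda>_. mean f)"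
  unfolding converges_in_probability_def
proof (intro conjI allI impI)
  show "(\<lambda>w. 1 / real m * (\<Sum>i=1..m. f (X i w))) \<in> borel_measurable M" for m
    by (intro borel_measurable_times borel_measurable_sum borel_measurable_const) (auto intro: f_X_meas f)
  fix \<epsilon> :: real assume e: "\<epsilon> > 0"
  let ?E = "\<lambda>m. {w \<in> space M. \<bar>1 / real m * (\<Sum>i=1..m. f (X i w)) - mean f\<bar> > \<epsilon>}"
  have "prob (?E m) \<le> expectation (\<lambda>w. \<bar>dev f m w\<bar>) / real m / \<epsilon>" if m: "m \<ge> 1" for m
  proof -
    have "1 / real m * (\<Sum>i=1..m. f (X i w)) - mean f = dev f m w / real m" for w
      using m by (simp add: dev_def diff_divide_distrib)
    then have "?E m \<subseteq> {w \<in> space M. \<bar>dev f m w\<bar> \<ge> \<epsilon> * real m}"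
      using m by (auto simp: less_divide_eq intro: less_imp_le)
    then have "prob (?E m) \<le> prob {w \<in> space M. \<bar>dev f m w\<bar> \<ge> \<epsilon> * real m}"
      using dev_meas[OF f, of m] by (intro finite_measure_mono) auto
    also have "\<dots> \<le> expectation (\<lambda>w. \<bar>dev f m w\<bar>) / (\<epsilon> * real m)"
      using dev_integrable[OF f, of m] m e
      by (intro integral_Markov_inequality_measure[where A = "{}"]) auto
    finally show ?thesis by (simp add: mult.commute)
  qed
  then have le: "\<forall>\<^sub>F m in sequentially. prob (?E m) \<le> expectation (\<lambda>w. \<bar>dev f m w\<bar>) / real m / \<epsilon>"
    unfolding eventually_sequentially by blast
  have lim: "(\<lambda>m. expectation (\<lambda>w. \<bar>dev f m w\<bar>) / real m / \<epsilon>) \<longlonglongrightarrow> 0"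
    using tendsto_divide[OF mean_abs_dev_tendsto_zero[OF f] tendsto_const[of \<epsilon>]] e by simp
  show "(\<lambda>m. prob (?E m)) \<longlonglongrightarrow> 0"
    by (rule tendsto_sandwich[OF _ le tendsto_const lim]) simp
qed simp

end

theorem theorem1p1:
  fixes D :: "'a::euclidean_space set"
    and R :: "'a \<Rightarrow> real"
    and \<beta> :: "nat \<Rightarrow> 'a \<Rightarrow> real"
    and \<beta>lim :: "'a \<Rightarrow> real"
    and M :: "'w measure"
    and X :: "nat \<Rightarrow> 'w \<Rightarrow> 'a"
    and f :: "'a \<Rightarrow> real"
  assumes "compact D" and "emeasure lborel D > 0"
    and "R \<in> borel_measurable (restrict_space borel D)" and "\<forall>x\<in>D. R x \<ge> 0"
    and "(INF x\<in>D. R x) > 0"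
    and "\<forall>n. \<beta> n \<in> bounded_measurable_on D" and "\<forall>n. \<forall>x\<in>D. \<beta> n x > 0"
    and "\<exists>C. \<forall>n. \<forall>x\<in>D. \<beta> n x \<le> C"
    and "\<beta>lim \<in> bounded_measurable_on D"
    and "uniform_limit D \<beta> \<beta>lim sequentially"
    and "(INF x\<in>D. \<beta>lim x) > 0"
    and "prob_space M"
    and "sequential_points M D R \<beta> X"
    and "f \<in> bounded_measurable_on D"
  shows "(\<forall>m. \<forall>w\<in>space M.
            1 / real m * (\<integral>x. f x \<partial>point_measure_seq D X m w) = 1 / real m * (\<Sum>i=1..m. f (X i w))) \<and>
         converges_in_probability M
           (\<lambda>m w. 1 / real m * (\<integral>x. f x \<partial>point_measure_seq D X m w))
           (\<lambda>_. 1 / (LBINT x:D. \<beta>lim x) * (LBINT x:D. f x * \<beta>lim x))"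
proof -
  interpret prob_space M by fact
  obtain C where C: "\<forall>n. \<forall>x\<in>D. \<beta> n x \<le> C" using assms(8) by blast
  \<comment> \<open>A real infimum is a lower bound only for a set bounded below: here nonnegativity
    of \<open>R\<close> provides this, and boundedness does so for \<open>\<beta>lim\<close>. The
    two infima then serve as \<open>r\<close> and \<open>b\<close>.\<close>
  have "bdd_below (R ` D)" using assms(4) by (auto intro: bdd_belowI[of _ 0])
  then have R: "(INF x\<in>D. R x) \<le> R x" if "x \<in> D" for x using that by (rule cINF_lower)
  have "bdd_below (\<beta>lim ` D)"
    using assms(9) by (auto simp: bounded_measurable_on_def intro: bounded_imp_bdd_below)
  then have b: "(INF x\<in>D. \<beta>lim x) \<le> \<beta>lim x" if "x \<in> D" for x using that by (rule cINF_lower)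
  interpret interacting_points D R \<beta> \<beta>lim "INF x\<in>D. R x" "INF x\<in>D. \<beta>lim x" C M X
    using assms C R b by unfold_locales auto
  have eq: "(\<integral>x. f x \<partial>point_measure_seq D X m w) = (\<Sum>i=1..m. f (X i w))" if "w \<in> space M" for m w
    using that assms(14) by (intro integral_point_measure_seq X_in_D) (auto simp: bounded_measurable_on_def)
  have "converges_in_probability M (\<lambda>m w. 1 / real m * (\<integral>x. f x \<partial>point_measure_seq D X m w)) (\<lambda>_. mean f)
    \<longleftrightarrow> converges_in_probability M (\<lambda>m w. 1 / real m * (\<Sum>i=1..m. f (X i w))) (\<lambda>_. mean f)"
    by (rule converges_in_probability_cong) (simp add: eq)
  then show ?thesis using weak_law[OF assms(14)] eq by (auto simp: mean_def)
qed

end
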